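(* Let $N\ge1$, let $\Omega\subset\mathbb{R}^N$ be a bounded domain with smooth boundary, let $\sigma\in(0,1)$ and $p\in(2,\infty)$. Let $\lambda_1(\sigma)$ be the first eigenvalue of the fractional Dirichlet Laplacian of order $\sigma$ on $\Omega$. If $\lambda_1(\sigma)<1$, then the problem $$(-\Delta)^\sigma u+|u|^{p-1}\operatorname{sign}u-u=0\ \text{ in }\Omega,\qquad u=0\ \text{ in }\mathbb{R}^N\setminus\Omega,$$ admits a nontrivial weak solution.
   Context: For $r\in(0,1)$, $C(r):=\left(\int_{\mathbb{R}^N}\frac{1-\cos\zeta_1}{|\zeta|^{N+2r}}\,d\zeta\right)^{-1}$, $\mathcal{X}_{r,0}:=\{v\in H^r(\mathbb{R}^N): v=0\text{ a.e. in }\mathbb{R}^N\setminus\Omega\}$ with norm $\|v\|_{\mathcal{X}_{r,0}}^2:=\frac{C(r)}2\iint_{\mathbb{R}^{2N}}\frac{|v(x)-v(y)|^2}{|x-y|^{N+2r}}\,dx\,dy$, and $\lambda_1(r):=\min\{\|v\|_{\mathcal{X}_{r,0}}^2: v\in\mathcal{X}_{r,0},\ \|v\|_{L^2(\Omega)}=1\}$. $\mathcal{E}_\sigma:=\mathcal{X}_{\sigma,0}\cap L^p(\mathbb{R}^N)$, $\beta(v):=|v|^{p-1}\operatorname{sign}v$. A function $u\in\mathcal{E}_\sigma$ is a weak solution of the problem if for all $\varphi\in\mathcal{E}_\sigma$ $$\frac{C(\sigma)}2\iint_{\mathbb{R}^{2N}}\frac{(u(x)-u(y))(\varphi(x)-\varphi(y))}{|x-y|^{N+2\sigma}}\,dx\,dy+\int_\Omega\beta(u)\varphi\,dx-\int_\Omega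 u\varphi\,dx=0.$$ *)

theory Defs
  imports "HOL-Analysis.Analysis"
begin

text \<open>
  The space \<open>\<real>\<^sup>N\<close> is a type of class \<^class>\<open>euclidean_space\<close> with \<open>N = DIM('a) \<ge> 1\<close>.
  Elements of Lebesgue and Sobolev spaces are represented by Borel measurable functions;
  every Lebesgue measurable function has such a representative, and all notions
  below depend only on the class modulo null sets.
\<close>

subsection \<open>Domains with smooth boundary\<close>

text \<open>\<open>C\<^sup>k\<close> functions on the whole space, by recursion on partial derivatives.\<close>

primrec Ck :: "nat \<Rightarrow> ('a::euclidean_space \<Rightarrow> real) \<Rightarrow> bool" where
  "Ck 0 f \<longleftrightarrow> continuous_on UNIV f"
| "Ck (Suc k) f \<longleftrightarrow> (\<forall>x. f differentiable at x) \<and>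
     (\<forall>b\<in>Basis. Ck k (\<lambda>x. frechet_derivative f (at x) b))"

definition smooth :: "('a::euclidean_space \<Rightarrow> real) \<Rightarrow> bool" where
  "smooth f \<longleftrightarrow> (\<forall>k. Ck k f)"

text \<open>
  Near each boundary point the set is the region strictly above the graph of a smooth function,
  in direction \<open>e\<close>. A function of the \<open>N - 1\<close> coordinates orthogonal
  to \<open>e\<close> is encoded as a function on the whole space that is constant along \<open>e\<close>.
\<close>

definition smooth_boundary :: "'a::euclidean_space set \<Rightarrow> bool" where
  "smooth_boundary S \<longleftrightarrow>
     (\<forall>x0\<in>frontier S. \<exists>r>0. \<exists>e \<gamma>. norm e = 1 \<and> smooth \<gamma> \<and>
        (\<forall>x t. \<gamma> (x + t *\<^sub>R e) = \<gamma> x) \<and>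
        S \<inter> ball x0 r = {x \<in> ball x0 r. \<gamma> x < x \<bullet> e})"

definition bounded_smooth_domain :: "'a::euclidean_space set \<Rightarrow> bool" where
  "bounded_smooth_domain S \<longleftrightarrow>
     open S \<and> connected S \<and> S \<noteq> {} \<and> bounded S \<and> smooth_boundary S"

subsection \<open>Function spaces\<close>

definition Lp :: "real \<Rightarrow> ('a::euclidean_space \<Rightarrow> real) set" where
  "Lp p = {v \<in> borel_measurable lborel. integrable lborel (\<lambda>x. \<bar>v x\<bar> powr p)}"

text \<open>The diagonal, where division by zero gives the value 0, is a null set.\<close>

definition gagliardo_form ::
  "real \<Rightarrow> ('a::euclidean_space \<Rightarrow> real) \<Rightarrow> ('a \<Rightarrow> real) \<Rightarrow> 'a \<times> 'a \<Rightarrow> real" where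
  "gagliardo_form r u v = (\<lambda>(x, y).
     (u x - u y) * (v x - v y) / norm (x - y) powr (real DIM('a) + 2 * r))"

definition Hs :: "real \<Rightarrow> ('a::euclidean_space \<Rightarrow> real) set" where
  "Hs r = {v \<in> Lp 2. integrable (lborel \<Otimes>\<^sub>M lborel) (gagliardo_form r v v)}"

definition X0 :: "'a::euclidean_space set \<Rightarrow> real \<Rightarrow> ('a \<Rightarrow> real) set" where
  "X0 \<Omega> r = {v \<in> Hs r. AE x in lborel. x \<notin> \<Omega> \<longrightarrow> v x = 0}"

text \<open>
  The first coordinate \<open>\<zeta>\<^sub>1\<close> is the one along some fixed basis vector; by rotation invariance
  the integral does not depend on which.
\<close>

definition fl_const :: "'a::euclidean_space itself \<Rightarrow> real \<Rightarrow> real" where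
  "fl_const _ r = inverse (LINT \<zeta>|lborel.
     (1 - cos (\<zeta> \<bullet> (SOME b::'a. b \<in> Basis))) / norm \<zeta> powr (real DIM('a) + 2 * r))"

definition X0_inner ::
  "real \<Rightarrow> ('a::euclidean_space \<Rightarrow> real) \<Rightarrow> ('a \<Rightarrow> real) \<Rightarrow> real" where
  "X0_inner r u v =
     fl_const TYPE('a) r / 2 * (LINT z|(lborel \<Otimes>\<^sub>M lborel). gagliardo_form r u v z)"

text \<open>\<open>X0_inner r v v\<close> is the squared norm of \<open>v\<close>; \<open>LEAST\<close> denotes the minimum of the set.\<close>

definition first_eigenvalue :: "'a::euclidean_space set \<Rightarrow> real \<Rightarrow> real" where
  "first_eigenvalue \<Omega> r = (LEAST c. c \<in>
     {X0_inner r v v | v. v \<in> X0 \<Omega> r \<and> sqrt (LINT x:\<Omega>|lborel. (v x)\<^sup>2) = 1})"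

subsection \<open>Weak solutions\<close>

definition energy_space :: "'a::euclidean_space set \<Rightarrow> real \<Rightarrow> real \<Rightarrow> ('a \<Rightarrow> real) set" where
  "energy_space \<Omega> \<sigma> p = X0 \<Omega> \<sigma> \<inter> Lp p"

definition beta :: "real \<Rightarrow> real \<Rightarrow> real" where
  "beta p t = \<bar>t\<bar> powr (p - 1) * sgn t"

definition weak_solution ::
  "'a::euclidean_space set \<Rightarrow> real \<Rightarrow> real \<Rightarrow> ('a \<Rightarrow> real) \<Rightarrow> bool" where
  "weak_solution \<Omega> \<sigma> p u \<longleftrightarrow> u \<in> energy_space \<Omega> \<sigma> p \<and>
     (\<forall>\<phi>\<in>energy_space \<Omega> \<sigma> p.
        X0_inner \<sigma> u \<phi> + (LINT x:\<Omega>|lborel. beta p (u x) * \<phi> x)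
          - (LINT x:\<Omega>|lborel. u x * \<phi> x) = 0)"

end

theory Submission
  imports Defs "HOL-Complex_Analysis.Great_Picard"
begin

text \<open>
  The solution minimises the energy
  \<open>J u = \<parallel>u\<parallel>\<^sup>2 / 2 + \<integral> \<bar>u\<bar>\<^sup>p / p - \<integral> u\<^sup>2 / 2\<close>, which is coercive because \<open>p > 2\<close> and \<open>\<Omega>\<close> is bounded.
  Sequences bounded in \<open>X0\<close> have subsequences converging in \<open>L\<^sup>2\<close> and almost everywhere: on a grid
  of cubes of side \<open>h\<close> the seminorm bounds the \<open>L\<^sup>2\<close> distance to the cube averages by \<open>C h\<^sup>r\<close>,
  and the averages converge along a diagonal subsequence. With Fatou's lemma in place of weak lower
  semicontinuity, the minimum of \<open>J\<close> and the minimum defining \<open>\<lambda>\<^sub>1\<close> are both attained.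
  Testing \<open>J\<close> with a small multiple of a truncated first eigenfunction shows that the minimum is negative
  if \<open>\<lambda>\<^sub>1 < 1\<close>, so the minimiser is not zero. Its variations in the directions \<open>\<phi>\<close> and \<open>- \<phi>\<close>
  give the weak equation; convexity of \<open>\<bar>t\<bar>\<^sup>p\<close> replaces differentiation under the integral.
\<close>

text \<open>The signs compensate: the only negative term of the energy is the L^2 one, which passes
  to the limit exactly, while the two positive terms need only lower semicontinuity. Fatou's lemma
  supplies that from pointwise convergence, which is why compactness has to deliver almost
  everywhere convergence besides convergence of the L^2 norms. The hypothesis on
  \<open>first_eigenvalue\<close> carries information only if the minimum behind
  \<open>LEAST\<close> exists, hence the proof that it is attained. Integrals are total, with value
  0 when they diverge, so each limit passage must prove integrability together with its
  bound.\<close>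

section \<open>Fatou's lemma for real integrals, and integrals over pairs\<close>

text \<open>Integrability belongs to the conclusion: a divergent integral has the value 0, which
  would make the inequality empty.\<close>

lemma
  fixes f :: "nat \<Rightarrow> 'b \<Rightarrow> real"
  assumes f: "\<And>n. integrable M (f n)" and nn: "\<And>n x. 0 \<le> f n x"
    and g[measurable]: "g \<in> borel_measurable M"
    and lim: "AE x in M. (\<lambda>n. f n x) \<longlonglongrightarrow> g x"
    and L: "\<And>n. integral\<^sup>L M (f n) \<le> L"
  shows integrable_of_bounded_AE_lim: "integrable M g"
    and integral_le_bound_AE_lim: "integral\<^sup>L M g \<le> L"
proof -
  have [measurable]: "\<And>n. f n \<in> borel_measurable M" using f by auto
  have g0: "AE x in M. 0 \<le> g x"
    using lim by eventually_elim (rule LIMSEQ_le_const, auto simp: nn)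
  have "0 \<le> integral\<^sup>L M (f 0)" using nn by simp
  then have L0: "0 \<le> L" using L[of 0] by linarith
  have "(\<integral>\<^sup>+x. ennreal (g x) \<partial>M) = (\<integral>\<^sup>+x. liminf (\<lambda>n. ennreal (f n x)) \<partial>M)"
  proof (rule nn_integral_cong_AE, use lim in eventually_elim)
    case (elim x)
    then have "(\<lambda>n. ennreal (f n x)) \<longlonglongrightarrow> ennreal (g x)" by (rule tendsto_ennrealI)
    then show ?case by (simp add: lim_imp_Liminf)
  qed
  also have "\<dots> \<le> liminf (\<lambda>n. \<integral>\<^sup>+x. ennreal (f n x) \<partial>M)"
    by (rule nn_integral_liminf) auto
  also have "\<dots> = liminf (\<lambda>n. ennreal (integral\<^sup>L M (f n)))"
    using f nn by (simp add: nn_integral_eq_integral)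
  also have "\<dots> \<le> liminf (\<lambda>n. ennreal L)"
    by (intro Liminf_mono always_eventually allI ennreal_leI L)
  also have "\<dots> = ennreal L"
    by (rule Liminf_const) simp
  finally have *: "(\<integral>\<^sup>+x. ennreal (g x) \<partial>M) \<le> ennreal L" .
  then show gi: "integrable M g"
    by (intro integrableI_nonneg[OF g g0]) (simp add: le_less_trans)
  from * show "integral\<^sup>L M g \<le> L"
    using nn_integral_eq_integral[OF gi g0] L0 by (simp add: ennreal_le_iff)
qed

text \<open>Fatou's lemma sees only tails, and the tail of the integrals lies below
  \<open>L + e\<close>; so the uniform bound applies for every positive \<open>e\<close>.\<close>

lemma
  fixes f :: "nat \<Rightarrow> 'b \<Rightarrow> real"
  assumes f: "\<And>n. integrable M (f n)" and nn: "\<And>n x. 0 \<le> f n x"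
    and g: "g \<in> borel_measurable M"
    and lim: "AE x in M. (\<lambda>n. f n x) \<longlonglongrightarrow> g x"
    and L: "(\<lambda>n. integral\<^sup>L M (f n)) \<longlonglongrightarrow> L"
  shows integrable_of_AE_lim: "integrable M g"
    and integral_le_AE_lim: "integral\<^sup>L M g \<le> L"
proof -
  have *: "integrable M g \<and> integral\<^sup>L M g \<le> L + e" if "e > 0" for e
  proof -
    from order_tendstoD(2)[OF L, of "L + e"] that obtain N where
      N: "\<And>n. n \<ge> N \<Longrightarrow> integral\<^sup>L M (f n) < L + e"
      by (auto simp: eventually_sequentially)
    have lim': "AE x in M. (\<lambda>n. f (n + N) x) \<longlonglongrightarrow> g x"
      using lim by eventually_elim (rule LIMSEQ_ignore_initial_segment)
    have N': "integral\<^sup>L M (f (n + N)) \<le> L + e" for n using N[of "n + N"] by simp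
    show ?thesis
      using integrable_of_bounded_AE_lim[OF f nn g lim' N'] integral_le_bound_AE_lim[OF f nn g lim' N']
      by blast
  qed
  show "integrable M g" using *[of 1] by simp
  show "integral\<^sup>L M g \<le> L" by (rule field_le_epsilon) (rule *[THEN conjunct2])
qed

lemma
  fixes f g :: "'a::euclidean_space \<Rightarrow> real"
  assumes f: "integrable lborel f" and g: "integrable lborel g"
  shows integrable_pair_mult: "integrable (lborel \<Otimes>\<^sub>M lborel) (\<lambda>(x, y). f x * g y)"
    and integral_pair_mult: "(LINT z|(lborel \<Otimes>\<^sub>M lborel). (\<lambda>(x, y). f x * g y) z)
        = integral\<^sup>L lborel f * integral\<^sup>L lborel g"
proof -
  have [measurable]: "f \<in> borel_measurable lborel" "g \<in> borel_measurable lborel"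
    using f g by auto
  show *: "integrable (lborel \<Otimes>\<^sub>M lborel) (\<lambda>(x, y). f x * g y)"
    by (rule lborel_pair.Fubini_integrable) (use f g in \<open>auto simp: abs_mult\<close>)
  show "(LINT z|(lborel \<Otimes>\<^sub>M lborel). (\<lambda>(x, y). f x * g y) z)
        = integral\<^sup>L lborel f * integral\<^sup>L lborel g"
    by (subst lborel_pair.integral_fst'[OF *, symmetric]) simp
qed

text \<open>Compactness gives almost everywhere convergence on the space, whereas the Gagliardo
  integrand lives on pairs.\<close>

lemma AE_lborel_pair:
  assumes "AE x in lborel. P (x::'a::euclidean_space)"
  shows "AE z in lborel \<Otimes>\<^sub>M lborel. P (fst z) \<and> P (snd z)"
proof -
  from assms obtain N where N: "{x. \<not> P x} \<subseteq> N" "emeasure lborel N = 0" "N \<in> sets lborel"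
    by (auto elim!: AE_E)
  have [measurable]: "N \<in> sets lborel" by fact
  have pr: "Measurable.pred (lborel \<Otimes>\<^sub>M lborel) (\<lambda>z. fst z \<notin> N \<and> snd z \<notin> N)"
    by measurable
  have "AE x in lborel. x \<notin> N" using N by (intro AE_I[where N=N]) auto
  then have "AE x in lborel. AE y in lborel. fst (x, y) \<notin> N \<and> snd (x, y) \<notin> N"
    by (auto)
  then have "AE z in lborel \<Otimes>\<^sub>M lborel. fst z \<notin> N \<and> snd z \<notin> N"
    by (intro lborel_pair.AE_pair_measure predE[OF pr])
  then show ?thesis by eventually_elim (use N in auto)
qed

lemma ennreal_le_suminf: "f j \<le> suminf f" for f :: "nat \<Rightarrow> ennreal"
  using sum_le_suminf[of f "{j}"] by simp

subsection \<open>The Gagliardo kernel\<close>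

text \<open>The first sum dominates the kernel for \<open>norm z \<le> 1\<close>, the second one for \<open>norm z > 1\<close>.\<close>

lemma norm_powr_le_shells:
  fixes z :: "'a::euclidean_space"
  assumes r: "0 < r" "r < 1"
  defines "d \<equiv> real DIM('a)"
  shows "ennreal (min 1 ((norm z)\<^sup>2) / norm z powr (d + 2 * r))
    \<le> (\<Sum>j. ennreal (2 powr (real j * (d + 2 * r - 2) + (d + 2 * r))) * indicator (cball 0 (2 powr - real j)) z)
    + (\<Sum>j. ennreal (2 powr (- real j * (d + 2 * r))) * indicator (cball 0 (2 powr (real j + 1))) z)"
proof (cases "z = 0")
  case False
  define s where "s = norm z"
  have s: "s > 0" using False s_def by simp
  have d: "d \<ge> 1" unfolding d_def using DIM_positive[where 'a='a] by linarith
  show ?thesis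
  proof (cases "s \<le> 1")
    case True
    \<comment> \<open>Index of the dyadic shell
      \<open>2 powr (- real j - 1) \<le> s \<le> 2 powr - real j\<close>.\<close>
    define j where "j = nat \<lfloor>- log 2 s\<rfloor>"
    have "log 2 s \<le> 0" using s True by simp
    then have jj: "real j \<le> - log 2 s" "- log 2 s < real j + 1"
      unfolding j_def by linarith+
    have 1: "s \<le> 2 powr - real j"
      using less_log_iff[of 2 s "- real j"] jj(1) s by simp
    have 2: "2 powr (- real j - 1) \<le> s"
      using less_log_iff[of 2 s "- real j - 1"] jj(2) s by simp
    have sq: "s\<^sup>2 \<le> 2 powr (- 2 * real j)"
    proof -
      have "s\<^sup>2 \<le> (2 powr - real j)\<^sup>2" using 1 s by (intro power_mono) auto
      also have "\<dots> = 2 powr (- 2 * real j)" by (simp add: power2_eq_square flip: powr_add)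
      finally show ?thesis .
    qed
    have pw: "2 powr ((- real j - 1) * (d + 2 * r)) \<le> s powr (d + 2 * r)"
      unfolding powr_powr[symmetric] using 2 r d by (intro powr_mono2) auto
    \<comment> \<open>Numerator bounded at the outer radius, denominator at the inner one; the
      factor \<open>2 powr (d + 2 * r)\<close> is the price of the ratio 2 between the
      radii.\<close>
    have "min 1 (s\<^sup>2) / s powr (d + 2 * r) \<le> 2 powr (- 2 * real j) / 2 powr ((- real j - 1) * (d + 2 * r))"
      using sq pw by (intro frac_le) auto
    also have "\<dots> = 2 powr (real j * (d + 2 * r - 2) + (d + 2 * r))"
      by (simp add: powr_diff[symmetric] algebra_simps)
    finally have "ennreal (min 1 (s\<^sup>2) / s powr (d + 2 * r)) \<le>
      ennreal (2 powr (real j * (d + 2 * r - 2) + (d + 2 * r))) * indicator (cball 0 (2 powr - real j)) z"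
      using 1 by (simp add: s_def[symmetric] indicator_def ennreal_leI dist_norm)
    also have "\<dots> \<le> (\<Sum>j. ennreal (2 powr (real j * (d + 2 * r - 2) + (d + 2 * r))) * indicator (cball 0 (2 powr - real j)) z)"
      by (rule ennreal_le_suminf[of _ j])
    finally show ?thesis unfolding s_def by (rule order_trans) simp
  next
    case False
    define j where "j = nat \<lfloor>log 2 s\<rfloor>"
    have "log 2 s \<ge> 0" using s False by simp
    then have jj: "real j \<le> log 2 s" "log 2 s < real j + 1"
      unfolding j_def by linarith+
    have 1: "s \<le> 2 powr (real j + 1)"
      using le_log_iff[of 2 s "real j + 1"] jj(2) s by simp
    have 2: "2 powr (real j) \<le> s"
      using le_log_iff[of 2 s "real j"] jj(1) s by simp
    have pw: "2 powr (real j * (d + 2 * r)) \<le> s powr (d + 2 * r)"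
      unfolding powr_powr[symmetric] using 2 r d by (intro powr_mono2) auto
    have "min 1 (s\<^sup>2) / s powr (d + 2 * r) \<le> 1 / 2 powr (real j * (d + 2 * r))"
      using pw by (intro frac_le) auto
    also have "\<dots> = 2 powr (- real j * (d + 2 * r))"
      by (simp add: powr_minus_divide)
    finally have "ennreal (min 1 (s\<^sup>2) / s powr (d + 2 * r)) \<le>
      ennreal (2 powr (- real j * (d + 2 * r))) * indicator (cball 0 (2 powr (real j + 1))) z"
      using 1 by (simp add: s_def[symmetric] indicator_def ennreal_leI dist_norm)
    also have "\<dots> \<le> (\<Sum>j. ennreal (2 powr (- real j * (d + 2 * r))) * indicator (cball 0 (2 powr (real j + 1))) z)"
      by (rule ennreal_le_suminf[of _ j])
    finally show ?thesis unfolding s_def by (rule order_trans) simp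
  qed
qed simp

text \<open>The ball of radius \<open>2 powr t\<close> has volume \<open>B * 2 powr (t * d)\<close>,
  which cancels the \<open>d\<close> in the exponents. Both dyadic series become geometric, with
  ratio \<open>2 powr (2 * r - 2)\<close> at the origin and \<open>2 powr (- 2 * r)\<close> at
  infinity; these are below 1 by \<open>r < 1\<close> and \<open>0 < r\<close> respectively.\<close>

lemma kernel_integrable:
  assumes r: "0 < r" "r < 1"
  shows "integrable lborel (\<lambda>z::'a::euclidean_space. min 1 ((norm z)\<^sup>2) / norm z powr (real DIM('a) + 2 * r))"
proof (rule integrableI_nonneg)
  define d where "d = real DIM('a)"
  define B where "B = measure lborel (cball (0::'a) 1)"
  have ball: "emeasure lborel (cball (0::'a) (2 powr t)) = ennreal (B * 2 powr (t * d))" for t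
    unfolding B_def d_def by (subst emeasure_cball; simp add: content_cball powr_realpow[symmetric] powr_powr mult.commute)
  have B0: "0 \<le> B" unfolding B_def by simp
  have fin: "(\<Sum>j. ennreal (c * q powr real j)) < \<infinity>" if "0 \<le> c" "0 < q" "q < 1" for c q
  proof -
    have "summable (\<lambda>j. c * q ^ j)" using that by (intro summable_mult summable_geometric) auto
    then have "(\<Sum>j. ennreal (c * q powr real j)) = ennreal (\<Sum>j. c * q ^ j)"
      using that by (subst suminf_ennreal2) (auto simp: powr_realpow)
    then show ?thesis by simp
  qed
  have mb: "(\<lambda>z::'a. (c::ennreal) * indicator (cball 0 R) z) \<in> borel_measurable lborel" for c and R :: real
    by (intro borel_measurable_times_ennreal borel_measurable_const borel_measurable_indicator) simp
  have ms: "(\<lambda>z::'a. \<Sum>j. (c j::ennreal) * indicator (cball 0 (R j)) z) \<in> borel_measurable lborel"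
    for c and R :: "nat \<Rightarrow> real"
    by (intro borel_measurable_suminf_order mb)
  have sums: "(\<integral>\<^sup>+z. (\<Sum>j. c j * indicator (cball (0::'a) (R j)) z) \<partial>lborel)
      = (\<Sum>j. c j * emeasure lborel (cball (0::'a) (R j)))" for c and R :: "nat \<Rightarrow> real"
    by (subst nn_integral_suminf[OF mb]) (simp add: nn_integral_cmult_indicator)
  have t1: "ennreal (2 powr (real j * (d + 2 * r - 2) + (d + 2 * r))) * ennreal (B * 2 powr (- real j * d))
      = ennreal (B * 2 powr (d + 2 * r) * (2 powr (2 * r - 2)) powr real j)" for j
  proof -
    have "2 powr (real j * (d + 2 * r - 2) + (d + 2 * r)) * 2 powr (- real j * d)
        = (2::real) powr (d + 2 * r) * (2 powr (2 * r - 2)) powr real j"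
      unfolding powr_powr powr_add[symmetric] by (simp add: algebra_simps)
    then show ?thesis using B0 by (simp add: ennreal_mult''[symmetric] mult.left_commute)
  qed
  have t2: "ennreal (2 powr (- real j * (d + 2 * r))) * ennreal (B * 2 powr ((real j + 1) * d))
      = ennreal (B * 2 powr d * (2 powr (- 2 * r)) powr real j)" for j
  proof -
    have "2 powr (- real j * (d + 2 * r)) * 2 powr ((real j + 1) * d)
        = (2::real) powr d * (2 powr (- 2 * r)) powr real j"
      unfolding powr_powr powr_add[symmetric] by (simp add: algebra_simps)
    then show ?thesis using B0 by (simp add: ennreal_mult''[symmetric] mult.left_commute)
  qed
  have "(\<integral>\<^sup>+z. ennreal (min 1 ((norm (z::'a))\<^sup>2) / norm z powr (d + 2 * r)) \<partial>lborel)
    \<le> (\<integral>\<^sup>+z. (\<Sum>j. ennreal (2 powr (real j * (d + 2 * r - 2) + (d + 2 * r))) * indicator (cball (0::'a) (2 powr - real j)) z)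
    + (\<Sum>j. ennreal (2 powr (- real j * (d + 2 * r))) * indicator (cball 0 (2 powr (real j + 1))) z) \<partial>lborel)"
    by (intro nn_integral_mono) (use norm_powr_le_shells[OF r] in \<open>simp add: d_def\<close>)
  also have "\<dots> = (\<Sum>j. ennreal (2 powr (real j * (d + 2 * r - 2) + (d + 2 * r))) * emeasure lborel (cball (0::'a) (2 powr - real j)))
    + (\<Sum>j. ennreal (2 powr (- real j * (d + 2 * r))) * emeasure lborel (cball (0::'a) (2 powr (real j + 1))))"
    by (subst nn_integral_add[OF ms ms]) (simp only: sums)
  also have "\<dots> = (\<Sum>j. ennreal (B * 2 powr (d + 2 * r) * (2 powr (2 * r - 2)) powr real j))
    + (\<Sum>j. ennreal (B * 2 powr d * (2 powr (- 2 * r)) powr real j))"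
    unfolding ball using B0 by (simp only: t1 t2)
  also have "\<dots> < \<infinity>"
  proof -
    have "2 powr (2 * r - 2) < (1::real)" "2 powr (- 2 * r) < (1::real)"
      using r powr_less_mono[of "2 * r - 2" 0 2] powr_less_mono[of "- 2 * r" 0 2] by simp_all
    then have "(\<Sum>j. ennreal (B * 2 powr (d + 2 * r) * (2 powr (2 * r - 2)) powr real j)) < \<infinity>"
      "(\<Sum>j. ennreal (B * 2 powr d * (2 powr (- 2 * r)) powr real j)) < \<infinity>"
      using B0 by (intro fin; simp)+
    then show ?thesis by (simp only: infinity_ennreal_def ennreal_add_less_top)
  qed
  finally show "(\<integral>\<^sup>+z. ennreal (min 1 ((norm (z::'a))\<^sup>2) / norm z powr (real DIM('a) + 2 * r)) \<partial>lborel) < \<infinity>"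
    unfolding d_def .
qed auto

text \<open>If the defining integral diverged, its value and its inverse would be 0 and the seminorm
  would vanish identically. Integrability follows from 1 - cos t = 2 sin^2(t/2) \<le> 2 min(1, t^2)
  and the kernel bound. Positivity is read off on the unit box, where the chosen coordinate lies
  strictly between 0 and 1.\<close>

lemma fl_const_pos:
  assumes r: "0 < r" "r < 1"
  shows "fl_const TYPE('a::euclidean_space) r > 0"
proof -
  define b where "b = (SOME b::'a. b \<in> Basis)"
  have b: "b \<in> Basis" unfolding b_def by (rule someI_ex) (use nonempty_Basis in blast)
  define F where "F = (\<lambda>\<zeta>::'a. (1 - cos (\<zeta> \<bullet> b)) / norm \<zeta> powr (real DIM('a) + 2 * r))"
  have cosb: "1 - cos t \<le> 2 * min 1 (t\<^sup>2)" for t :: real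
  proof -
    have "1 - cos t = 2 * (sin (t/2))\<^sup>2"
      using cos_double_sin[of "t/2"] by simp
    moreover have "(sin (t/2))\<^sup>2 \<le> (t/2)\<^sup>2"
      using abs_sin_x_le_abs_x[of "t/2"] unfolding abs_le_square_iff .
    moreover have "(sin (t/2))\<^sup>2 \<le> 1" by (simp add: abs_square_le_1)
    moreover have "(t/2)\<^sup>2 = t\<^sup>2 / 4" "0 \<le> t\<^sup>2" by (simp_all add: power_divide)
    ultimately have "1 - cos t \<le> 2 * t\<^sup>2" "1 - cos t \<le> 2 * 1" by linarith+
    then show ?thesis unfolding min_def by (simp split: if_split)
  qed
  have [measurable]: "F \<in> borel_measurable lborel" unfolding F_def by measurable
  have Fi: "integrable lborel F"
  proof (rule Bochner_Integration.integrable_bound)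
    show "integrable lborel (\<lambda>z::'a. 2 * (min 1 ((norm z)\<^sup>2) / norm z powr (real DIM('a) + 2 * r)))"
      using kernel_integrable[OF r] by (rule integrable_mult_right)
    have "norm (F z) \<le> norm (2 * (min 1 ((norm z)\<^sup>2) / norm z powr (real DIM('a) + 2 * r)))" for z
    proof -
      have "1 - cos (z \<bullet> b) \<le> 2 * min 1 ((z \<bullet> b)\<^sup>2)" by (rule cosb)
      also have "(z \<bullet> b)\<^sup>2 \<le> (norm z)\<^sup>2"
        using Basis_le_norm[OF b, of z] by (metis abs_le_square_iff abs_norm_cancel)
      then have "2 * min 1 ((z \<bullet> b)\<^sup>2) \<le> 2 * min 1 ((norm z)\<^sup>2)" by auto
      finally show ?thesis
        unfolding F_def by (simp add: abs_mult divide_right_mono)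
    qed
    then show "AE z in lborel. norm (F z) \<le> norm (2 * (min 1 ((norm z)\<^sup>2) / norm z powr (real DIM('a) + 2 * r)))"
      by simp
  qed measurable
  have F0: "F z \<ge> 0" for z unfolding F_def by simp
  have "integral\<^sup>L lborel F \<noteq> 0"
  proof
    assume "integral\<^sup>L lborel F = 0"
    then have ae: "AE z in lborel. F z = 0"
      using integral_nonneg_eq_0_iff_AE[OF Fi] F0 by auto
    have nz: "F z \<noteq> 0" if "z \<in> box 0 One" for z
    proof -
      have z: "0 < z \<bullet> b" "z \<bullet> b < 1" using that b by (auto simp: mem_box)
      then have "cos (z \<bullet> b) < cos 0" using pi_gt3 by (subst cos_mono_less_eq) auto
      moreover have "z \<noteq> 0" using z by auto
      ultimately show ?thesis unfolding F_def by simp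
    qed
    from ae have "AE z in lborel. z \<notin> box (0::'a) One"
      by eventually_elim (use nz in blast)
    then have "emeasure lborel (box (0::'a) One) = 0"
      using AE_iff_measurable[of "box (0::'a) One" lborel "\<lambda>z. z \<notin> box 0 One"] by simp
    then show False by (simp add: emeasure_lborel_box_eq)
  qed
  moreover have "integral\<^sup>L lborel F \<ge> 0" by (simp add: F0)
  ultimately have "integral\<^sup>L lborel F > 0" by linarith
  then show ?thesis
    unfolding fl_const_def F_def b_def by (rule positive_imp_inverse_positive)
qed

subsection \<open>The energy spaces\<close>

lemma Lp_2_iff:
  "v \<in> Lp 2 \<longleftrightarrow> v \<in> borel_measurable lborel \<and> integrable lborel (\<lambda>x. (v x)\<^sup>2)"
  unfolding Lp_def by simp

lemma X0_iff:
  "v \<in> X0 \<Omega> r \<longleftrightarrow> v \<in> borel_measurable lborel \<and> integrable lborel (\<lambda>x. (v x)\<^sup>2)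
    \<and> integrable (lborel \<Otimes>\<^sub>M lborel) (gagliardo_form r v v) \<and> (AE x in lborel. x \<notin> \<Omega> \<longrightarrow> v x = 0)"
  unfolding X0_def Hs_def Lp_2_iff by auto

lemma gagliardo_form_measurable [measurable]:
  assumes [measurable]: "u \<in> borel_measurable lborel" "v \<in> borel_measurable lborel"
  shows "gagliardo_form r u v \<in> borel_measurable (lborel \<Otimes>\<^sub>M lborel)"
  unfolding gagliardo_form_def by measurable

lemma gagliardo_form_self_nonneg: "0 \<le> gagliardo_form r u u z"
  unfolding gagliardo_form_def by (auto split: prod.split)

lemma abs_mult_le_squares: "\<bar>a * b\<bar> \<le> a\<^sup>2 + b\<^sup>2" for a b :: real
proof -
  have "2 * (\<bar>a\<bar> * \<bar>b\<bar>) \<le> a\<^sup>2 + b\<^sup>2"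
    using sum_squares_bound[of "\<bar>a\<bar>" "\<bar>b\<bar>"] by simp
  moreover have "0 \<le> \<bar>a\<bar> * \<bar>b\<bar>" by simp
  ultimately show ?thesis unfolding abs_mult by linarith
qed

lemma integrable_mult_L2:
  fixes u v :: "'b \<Rightarrow> real"
  assumes [measurable]: "u \<in> borel_measurable M" "v \<in> borel_measurable M"
    and "integrable M (\<lambda>x. (u x)\<^sup>2)" "integrable M (\<lambda>x. (v x)\<^sup>2)"
  shows "integrable M (\<lambda>x. u x * v x)"
proof (rule Bochner_Integration.integrable_bound)
  show "integrable M (\<lambda>x. (u x)\<^sup>2 + (v x)\<^sup>2)" using assms by simp
  show "AE x in M. norm (u x * v x) \<le> norm ((u x)\<^sup>2 + (v x)\<^sup>2)"
    using abs_mult_le_squares by simp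
qed measurable

lemma gagliardo_form_integrable:
  assumes [measurable]: "u \<in> borel_measurable lborel" "v \<in> borel_measurable lborel"
    and "integrable (lborel \<Otimes>\<^sub>M lborel) (gagliardo_form r u u)"
      "integrable (lborel \<Otimes>\<^sub>M lborel) (gagliardo_form r v v)"
  shows "integrable (lborel \<Otimes>\<^sub>M lborel) (gagliardo_form r u v)"
proof (rule Bochner_Integration.integrable_bound)
  show "integrable (lborel \<Otimes>\<^sub>M lborel) (\<lambda>z. gagliardo_form r u u z + gagliardo_form r v v z)"
    using assms by simp
  have "\<bar>a * b / n\<bar> \<le> a * a / n + b * b / n" if "0 \<le> n" for a b n :: real
  proof -
    have "\<bar>a * b\<bar> \<le> a * a + b * b"
      using abs_mult_le_squares[of a b] by (simp only: power2_eq_square)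
    then show ?thesis using that by (simp add: add_divide_distrib[symmetric] divide_right_mono abs_divide)
  qed
  then have "norm (gagliardo_form r u v z) \<le> gagliardo_form r u u z + gagliardo_form r v v z" for z
    unfolding gagliardo_form_def by (simp add: case_prod_beta)
  then show "AE z in lborel \<Otimes>\<^sub>M lborel. norm (gagliardo_form r u v z)
      \<le> norm (gagliardo_form r u u z + gagliardo_form r v v z)"
    by (intro AE_I2) (metis abs_ge_self order_trans real_norm_def)
qed measurable

lemma X0_gagliardo_integrable:
  "u \<in> X0 \<Omega> r \<Longrightarrow> v \<in> X0 \<Omega> r \<Longrightarrow> integrable (lborel \<Otimes>\<^sub>M lborel) (gagliardo_form r u v)"
  by (auto simp: X0_iff intro: gagliardo_form_integrable)

lemma gagliardo_form_add_scaled: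
  "gagliardo_form r (\<lambda>x. u x + t * v x) (\<lambda>x. u x + t * v x) z
   = gagliardo_form r u u z + (2 * t) * gagliardo_form r u v z + t\<^sup>2 * gagliardo_form r v v z"
  unfolding gagliardo_form_def
  by (simp add: case_prod_beta add_divide_distrib[symmetric] power2_eq_square algebra_simps)

lemma
  assumes u: "u \<in> X0 \<Omega> r" and v: "v \<in> X0 \<Omega> r"
  shows X0_add_scaled: "(\<lambda>x. u x + t * v x) \<in> X0 \<Omega> r"
    and X0_inner_add_scaled: "X0_inner r (\<lambda>x. u x + t * v x) (\<lambda>x. u x + t * v x)
      = X0_inner r u u + 2 * t * X0_inner r u v + t\<^sup>2 * X0_inner r v v"
proof -
  note * = u[unfolded X0_iff] v[unfolded X0_iff]
  have [measurable]: "u \<in> borel_measurable lborel" "v \<in> borel_measurable lborel" using * by auto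
  note uu = X0_gagliardo_integrable[OF u u] and uv = X0_gagliardo_integrable[OF u v]
    and vv = X0_gagliardo_integrable[OF v v]
  have eq: "gagliardo_form r (\<lambda>x. u x + t * v x) (\<lambda>x. u x + t * v x)
      = (\<lambda>z. gagliardo_form r u u z + (2 * t) * gagliardo_form r u v z + t\<^sup>2 * gagliardo_form r v v z)"
    by (rule ext) (rule gagliardo_form_add_scaled)
  have "integrable lborel (\<lambda>x. (u x)\<^sup>2 + 2 * t * (u x * v x) + t\<^sup>2 * (v x)\<^sup>2)"
    using * integrable_mult_L2[of u lborel v] by auto
  also have "(\<lambda>x. (u x)\<^sup>2 + 2 * t * (u x * v x) + t\<^sup>2 * (v x)\<^sup>2) = (\<lambda>x. (u x + t * v x)\<^sup>2)"
    by (auto simp: power2_eq_square algebra_simps)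
  finally have sq: "integrable lborel (\<lambda>x. (u x + t * v x)\<^sup>2)" .
  have ae: "AE x in lborel. x \<notin> \<Omega> \<longrightarrow> u x + t * v x = 0"
  proof -
    have "AE x in lborel. x \<notin> \<Omega> \<longrightarrow> u x = 0" "AE x in lborel. x \<notin> \<Omega> \<longrightarrow> v x = 0"
      using * by auto
    then show ?thesis by eventually_elim auto
  qed
  show "(\<lambda>x. u x + t * v x) \<in> X0 \<Omega> r"
    unfolding X0_iff eq using uu uv vv sq ae by auto
  show "X0_inner r (\<lambda>x. u x + t * v x) (\<lambda>x. u x + t * v x)
      = X0_inner r u u + 2 * t * X0_inner r u v + t\<^sup>2 * X0_inner r v v"
    unfolding X0_inner_def eq using uu uv vv by (simp add: algebra_simps)
qed

lemma X0_inner_nonneg: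
  assumes "0 < r" "r < 1"
  shows "0 \<le> X0_inner r v (v :: 'a::euclidean_space \<Rightarrow> real)"
  unfolding X0_inner_def
  using fl_const_pos[OF assms, where 'a='a]
  by (intro mult_nonneg_nonneg Bochner_Integration.integral_nonneg gagliardo_form_self_nonneg) auto

lemma gagliardo_form_zero: "gagliardo_form r (\<lambda>_. 0) v = (\<lambda>_. 0)"
  by (auto simp: fun_eq_iff gagliardo_form_def)

lemma X0_zero: "(\<lambda>_. 0) \<in> X0 \<Omega> r"
  unfolding X0_iff gagliardo_form_zero by simp

lemma X0_inner_zero: "X0_inner r (\<lambda>_. 0) v = 0"
  unfolding X0_inner_def gagliardo_form_zero by simp

lemma
  assumes "v \<in> X0 \<Omega> r"
  shows X0_scale: "(\<lambda>x. t * v x) \<in> X0 \<Omega> r"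
    and X0_inner_scale: "X0_inner r (\<lambda>x. t * v x) (\<lambda>x. t * v x) = t\<^sup>2 * X0_inner r v v"
  using X0_add_scaled[OF X0_zero assms, of t] X0_inner_add_scaled[OF X0_zero assms, of t]
  by (simp_all add: X0_inner_zero)

text \<open>A 1-Lipschitz \<open>f\<close> shrinks every difference \<open>u x - u y\<close>, so the
  Gagliardo integrand decreases pointwise. The intended \<open>f\<close> is a truncation.\<close>

lemma
  fixes u :: "'a::euclidean_space \<Rightarrow> real"
  assumes u: "u \<in> X0 \<Omega> r" and f[measurable]: "f \<in> borel_measurable borel"
    and f0: "f 0 = 0" and f1: "\<And>a b. \<bar>f a - f b\<bar> \<le> \<bar>a - b\<bar>"
    and r: "0 < r" "r < 1"
  shows X0_contraction: "(\<lambda>x. f (u x)) \<in> X0 \<Omega> r"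
    and X0_inner_contraction: "X0_inner r (\<lambda>x. f (u x)) (\<lambda>x. f (u x)) \<le> X0_inner r u u"
proof -
  have [measurable]: "u \<in> borel_measurable lborel" using u by (auto simp: X0_iff)
  have *: "gagliardo_form r (\<lambda>x. f (u x)) (\<lambda>x. f (u x)) z \<le> gagliardo_form r u u z" for z
  proof -
    have "(f (u (fst z)) - f (u (snd z))) * (f (u (fst z)) - f (u (snd z)))
      \<le> (u (fst z) - u (snd z)) * (u (fst z) - u (snd z))"
      using f1[of "u (fst z)" "u (snd z)"] unfolding abs_le_square_iff power2_eq_square .
    then show ?thesis
      unfolding gagliardo_form_def by (simp add: case_prod_beta divide_right_mono)
  qed
  have g: "integrable (lborel \<Otimes>\<^sub>M lborel) (gagliardo_form r (\<lambda>x. f (u x)) (\<lambda>x. f (u x)))"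
    by (rule Bochner_Integration.integrable_bound[OF X0_gagliardo_integrable[OF u u]])
      (auto simp: gagliardo_form_self_nonneg *)
  have "integrable lborel (\<lambda>x. (f (u x))\<^sup>2)"
  proof (rule Bochner_Integration.integrable_bound)
    show "integrable lborel (\<lambda>x. (u x)\<^sup>2)" using u by (simp add: X0_iff)
    show "AE x in lborel. norm ((f (u x))\<^sup>2) \<le> norm ((u x)\<^sup>2)"
      using f1[of _ 0] by (simp add: f0 abs_le_square_iff)
  qed measurable
  moreover have "AE x in lborel. x \<notin> \<Omega> \<longrightarrow> u x = 0" using u by (simp add: X0_iff)
  then have "AE x in lborel. x \<notin> \<Omega> \<longrightarrow> f (u x) = 0"
    by eventually_elim (auto simp: f0)
  ultimately show "(\<lambda>x. f (u x)) \<in> X0 \<Omega> r"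
    using g by (auto simp: X0_iff)
  show "X0_inner r (\<lambda>x. f (u x)) (\<lambda>x. f (u x)) \<le> X0_inner r u u"
    unfolding X0_inner_def
    using fl_const_pos[OF r, where 'a='a]
    by (intro mult_left_mono integral_mono g X0_gagliardo_integrable[OF u u] *) auto
qed

text \<open>Bridge between the definitions, which integrate over \<open>\<Omega>\<close>, and the
  rest of the proof, which integrates over the whole space.\<close>

lemma LINT_restrict_eq:
  fixes g :: "'a::euclidean_space \<Rightarrow> real"
  assumes "open \<Omega>" and "AE x in lborel. x \<notin> \<Omega> \<longrightarrow> g x = 0"
    and [measurable]: "g \<in> borel_measurable lborel"
  shows "(LINT x:\<Omega>|lborel. g x) = (LINT x|lborel. g x)"
proof -
  have [measurable]: "\<Omega> \<in> sets borel" using assms(1) by simp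
  show ?thesis unfolding set_lebesgue_integral_def
    by (rule integral_cong_AE, simp_all, use assms(2) in eventually_elim)
      (auto simp: indicator_def)
qed

lemma
  fixes K :: "'a::euclidean_space \<Rightarrow> real"
  assumes K: "integrable lborel K"
  shows integrable_lborel_translate: "integrable lborel (\<lambda>y. K (c + y))"
    and integral_lborel_translate: "(LINT y|lborel. K (c + y)) = integral\<^sup>L lborel K"
proof -
  have [measurable]: "K \<in> borel_measurable borel" using K by auto
  have "integrable (distr lborel borel ((+) c)) K" using K by (simp add: lborel_distr_plus)
  then show "integrable lborel (\<lambda>y. K (c + y))" by (subst (asm) integrable_distr_eq) auto
  have "integral\<^sup>L lborel K = integral\<^sup>L (distr lborel borel ((+) c)) K" by (simp add: lborel_distr_plus)
  also have "\<dots> = (LINT y|lborel. K (c + y))" by (subst integral_distr) auto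
  finally show "(LINT y|lborel. K (c + y)) = integral\<^sup>L lborel K" ..
qed

text \<open>If \<open>X0 \<Omega> r\<close> were trivial, the \<open>LEAST\<close> in \<^const>\<open>first_eigenvalue\<close> would be unspecified.\<close>

lemma X0_nontrivial:
  fixes \<Omega> :: "'a::euclidean_space set"
  assumes \<Omega>: "open \<Omega>" "\<Omega> \<noteq> {}" and r: "0 < r" "r < 1"
  obtains v where "v \<in> X0 \<Omega> r" "(LINT x|lborel. (v x)\<^sup>2) = 1"
proof -
  obtain x0 e where e: "e > 0" "ball x0 e \<subseteq> \<Omega>"
    using \<Omega> by (meson all_not_in_conv open_contains_ball)
  \<comment> \<open>The cap 1 on the radius keeps the tent function \<open>v\<close> below 1, so
    that (v x - v y)^2 is at most the numerator of the kernel at \<open>x - y\<close>.\<close>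
  define \<rho> where "\<rho> = min e 1"
  have \<rho>: "0 < \<rho>" "\<rho> \<le> 1" "\<rho> \<le> e" unfolding \<rho>_def using e by auto
  define B where "B = ball x0 \<rho>"
  have B\<Omega>: "B \<subseteq> \<Omega>" unfolding B_def using e \<rho> by auto
  have [measurable]: "B \<in> sets borel" unfolding B_def by simp
  have Bfin: "emeasure lborel B < \<infinity>" unfolding B_def by (rule emeasure_lborel_ball_finite)
  have IB: "integrable lborel (indicator B :: 'a \<Rightarrow> real)"
    using Bfin by (intro integrable_real_indicator) auto
  define v where "v = (\<lambda>x. max 0 (\<rho> - norm (x - x0)))"
  have [measurable]: "v \<in> borel_measurable lborel" unfolding v_def by measurable
  have v0: "v x = 0" if "x \<notin> B" for x
    using that unfolding v_def B_def by (auto simp: dist_norm norm_minus_commute)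
  have v1: "0 \<le> v x" "v x \<le> 1" for x unfolding v_def using \<rho> by (auto simp: max_def intro: order_trans[of _ \<rho>])
  have vL: "\<bar>v x - v y\<bar> \<le> norm (x - y)" for x y
  proof -
    have "\<bar>norm (x - x0) - norm (y - x0)\<bar> \<le> norm (x - y)"
      using norm_triangle_ineq3[of "x - x0" "y - x0"] by simp
    then show ?thesis unfolding v_def by (auto simp: max_def abs_if split: if_splits)
  qed
  have sq: "integrable lborel (\<lambda>x. (v x)\<^sup>2)"
  proof (rule Bochner_Integration.integrable_bound[OF IB])
    show "AE x in lborel. norm ((v x)\<^sup>2) \<le> norm (indicator B x :: real)"
      using v1 v0 by (auto simp: indicator_def abs_square_le_1)
  qed measurable
  define K where "K = (\<lambda>z::'a. min 1 ((norm z)\<^sup>2) / norm z powr (real DIM('a) + 2 * r))"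
  have K: "integrable lborel K" unfolding K_def by (rule kernel_integrable[OF r])
  have Kmin: "K (x - y) = K (- x + y)" for x y
    unfolding K_def norm_minus_commute[of x y] by simp
  have K0: "K z \<ge> 0" for z unfolding K_def by simp
  have [measurable]: "K \<in> borel_measurable borel"
    using borel_measurable_integrable[OF K] by simp
  have tr: "integrable lborel (\<lambda>y. K (x - y))" "(LINT y|lborel. K (x - y)) = integral\<^sup>L lborel K" for x
    using integrable_lborel_translate[OF K, of "- x"] integral_lborel_translate[OF K, of "- x"]
    by (simp_all only: Kmin[symmetric])
  \<comment> \<open>For fixed \<open>x\<close> the inner integral is that of a translate of
    \<open>K\<close>, hence the same for all \<open>x\<close>; what remains is the volume of the
    ball.\<close>
  have i1: "integrable (lborel \<Otimes>\<^sub>M lborel) (\<lambda>(x, y). indicator B x * K (x - y))"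
  proof (rule lborel_pair.Fubini_integrable)
    have "(\<lambda>x. LINT y|lborel. norm (case (x, y) of (x, y) \<Rightarrow> indicator B x * K (x - y)))
        = (\<lambda>x. indicator B x * integral\<^sup>L lborel K)"
      using tr(2) K0 by (simp add: abs_mult)
    then show "integrable lborel (\<lambda>x. LINT y|lborel. norm (case (x, y) of (x, y) \<Rightarrow> indicator B x * K (x - y)))"
      using IB by simp
    show "AE x in lborel. integrable lborel (\<lambda>y. case (x, y) of (x, y) \<Rightarrow> indicator B x * K (x - y))"
      using tr(1) by simp
  qed measurable
  have i2: "integrable (lborel \<Otimes>\<^sub>M lborel) (\<lambda>(x, y). indicator B y * K (x - y))"
    using lborel_pair.integrable_product_swap[OF i1]
    by (simp add: case_prod_beta) (simp add: K_def norm_minus_commute)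
  have "integrable (lborel \<Otimes>\<^sub>M lborel) (gagliardo_form r v v)"
  proof (rule Bochner_Integration.integrable_bound)
    show "integrable (lborel \<Otimes>\<^sub>M lborel) (\<lambda>z. (case z of (x, y) \<Rightarrow> indicator B x * K (x - y))
        + (case z of (x, y) \<Rightarrow> indicator B y * K (x - y)))"
      using i1 i2 by (rule Bochner_Integration.integrable_add)
    \<comment> \<open>A pair contributes only if one of its points lies in \<open>B\<close>; each of
      the two strips carries one dominating term.\<close>
    have "gagliardo_form r v v (x, y) \<le> indicator B x * K (x - y) + indicator B y * K (x - y)" for x y
    proof (cases "x \<in> B \<or> y \<in> B")
      case True
      have "(v x - v y)\<^sup>2 \<le> (norm (x - y))\<^sup>2"
        using vL[of x y] by (metis abs_le_square_iff abs_norm_cancel)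
      moreover have "\<bar>v x - v y\<bar> \<le> 1" using v1[of x] v1[of y] by auto
      then have "(v x - v y)\<^sup>2 \<le> 1" by (simp add: abs_square_le_1)
      ultimately have "gagliardo_form r v v (x, y) \<le> K (x - y)"
        unfolding gagliardo_form_def K_def by (simp add: power2_eq_square divide_right_mono)
      then show ?thesis using True K0[of "x - y"] by (auto simp: indicator_def)
    next
      case False
      then show ?thesis by (simp add: gagliardo_form_def v0)
    qed
    then show "AE z in lborel \<Otimes>\<^sub>M lborel. norm (gagliardo_form r v v z)
       \<le> norm ((case z of (x, y) \<Rightarrow> indicator B x * K (x - y)) + (case z of (x, y) \<Rightarrow> indicator B y * K (x - y)))"
      by (intro AE_I2) (auto simp: gagliardo_form_self_nonneg split: prod.split intro: order_trans[OF _ abs_ge_self])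
  qed measurable
  then have vX: "v \<in> X0 \<Omega> r"
    unfolding X0_iff using sq v0 B\<Omega> by auto
  define a where "a = (LINT x|lborel. (v x)\<^sup>2)"
  have "a \<noteq> 0"
  proof
    assume "a = 0"
    then have "AE x in lborel. (v x)\<^sup>2 = 0"
      unfolding a_def using integral_nonneg_eq_0_iff_AE[OF sq] by auto
    then have "AE x in lborel. x \<notin> B"
      by eventually_elim (auto simp: v_def B_def dist_norm norm_minus_commute)
    then have "emeasure lborel B = 0"
      using AE_iff_measurable[of B lborel "\<lambda>x. x \<notin> B"] by simp
    then have "measure lborel B = 0" by (simp add: measure_def)
    then show False using content_ball_pos[OF \<rho>(1), of x0] by (simp add: B_def)
  qed
  moreover have "a \<ge> 0" unfolding a_def by simp
  ultimately have a: "a > 0" by linarith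
  show thesis
  proof (rule that[OF X0_scale[OF vX, of "1 / sqrt a"]])
    have "(LINT x|lborel. (1 / sqrt a * v x)\<^sup>2) = (LINT x|lborel. 1 / a * (v x)\<^sup>2)"
      using a by (simp add: power_mult_distrib power_divide)
    also have "\<dots> = 1" using a by (simp add: a_def[symmetric])
    finally show "(LINT x|lborel. (1 / sqrt a * v x)\<^sup>2) = 1" .
  qed
qed

subsection \<open>Compactness\<close>

text \<open>A half-open cube of side \<open>h\<close> is encoded by its lower corner divided by \<open>h\<close>.\<close>

definition cell :: "real \<Rightarrow> 'a::euclidean_space \<Rightarrow> 'a" where
  "cell h x = (\<Sum>b\<in>Basis. real_of_int \<lfloor>x \<bullet> b / h\<rfloor> *\<^sub>R b)"

lemma cell_inner: "b \<in> Basis \<Longrightarrow> cell h x \<bullet> b = real_of_int \<lfloor>x \<bullet> b / h\<rfloor>"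
  unfolding cell_def by simp

lemma cell_measurable [measurable]: "cell h \<in> borel_measurable borel"
  unfolding cell_def by measurable

lemma cell_sets [measurable]: "{x. cell h x = c} \<in> sets borel"
proof -
  have "cell h -` {c} \<inter> space borel \<in> sets borel" by (rule measurable_sets[OF cell_measurable]) simp
  then show ?thesis by (simp add: vimage_def)
qed

lemma norm_diff_cell:
  fixes x y :: "'a::euclidean_space"
  assumes "0 < h" "cell h x = cell h y"
  shows "norm (x - y) \<le> real DIM('a) * h"
proof -
  have "\<bar>(x - y) \<bullet> b\<bar> \<le> h" if b: "b \<in> Basis" for b
  proof -
    have "\<lfloor>x \<bullet> b / h\<rfloor> = \<lfloor>y \<bullet> b / h\<rfloor>"
      using assms(2) cell_inner[OF b, of h x] cell_inner[OF b, of h y] by simp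
    then have "\<bar>x \<bullet> b / h - y \<bullet> b / h\<bar> \<le> 1" by linarith
    then have "\<bar>(x \<bullet> b - y \<bullet> b) / h\<bar> \<le> 1" by (simp add: diff_divide_distrib)
    then show ?thesis using assms(1) by (simp add: inner_diff_left abs_divide)
  qed
  then have "(\<Sum>b\<in>Basis. \<bar>(x - y) \<bullet> b\<bar>) \<le> (\<Sum>b\<in>(Basis::'a set). h)" by (intro sum_mono) auto
  then show ?thesis using norm_le_l1[of "x - y"] by simp
qed

lemma finite_cell_image:
  fixes S :: "'a::euclidean_space set"
  assumes S: "bounded S" and h: "0 < h"
  shows "finite (cell h ` S)"
proof -
  obtain R where R: "\<And>x. x \<in> S \<Longrightarrow> norm x \<le> R" using S by (auto simp: bounded_iff)
  define K where "K = \<lceil>R / h\<rceil> + 1"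
  define P where "P = (PiE (Basis::'a set) (\<lambda>_. {-K..K}))"
  have "cell h ` S \<subseteq> (\<lambda>f. \<Sum>b\<in>Basis. real_of_int (f b) *\<^sub>R b) ` P"
  proof
    fix c assume "c \<in> cell h ` S"
    then obtain x where x: "x \<in> S" "c = cell h x" by auto
    have "\<lfloor>x \<bullet> b / h\<rfloor> \<in> {-K..K}" if b: "b \<in> Basis" for b
    proof -
      have "\<bar>x \<bullet> b\<bar> \<le> R" using Basis_le_norm[OF b, of x] R[OF x(1)] by linarith
      then have "\<bar>x \<bullet> b\<bar> / h \<le> R / h" using h by (simp add: divide_right_mono)
      then have "\<bar>x \<bullet> b / h\<bar> \<le> R / h" using h by (simp add: abs_divide)
      then show ?thesis unfolding K_def atLeastAtMost_iff by linarith
    qed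
    then have "restrict (\<lambda>b. \<lfloor>x \<bullet> b / h\<rfloor>) Basis \<in> P" unfolding P_def by auto
    moreover have "c = (\<Sum>b\<in>Basis. real_of_int (restrict (\<lambda>b. \<lfloor>x \<bullet> b / h\<rfloor>) Basis b) *\<^sub>R b)"
      unfolding x(2) cell_def by (intro sum.cong) auto
    ultimately show "c \<in> (\<lambda>f. \<Sum>b\<in>Basis. real_of_int (f b) *\<^sub>R b) ` P" by blast
  qed
  moreover have "finite P" unfolding P_def by (intro finite_PiE) auto
  ultimately show ?thesis by (meson finite_imageI finite_subset)
qed

text \<open>A cell is squeezed between an open box of side \<open>h\<close> and a ball. Dividing by
  the volume of a cell requires only the lower bound.\<close>

lemma
  fixes x0 :: "'a::euclidean_space"
  assumes h: "0 < h"
  shows emeasure_cell_finite: "emeasure lborel {x. cell h x = cell h x0} < \<infinity>"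
    and measure_cell_ge: "h ^ DIM('a) \<le> measure lborel {x. cell h x = cell h x0}"
proof -
  have "{x. cell h x = cell h x0} \<subseteq> cball x0 (real DIM('a) * h)"
    using norm_diff_cell[OF h, of x0] by (auto simp: dist_norm)
  then have "emeasure lborel {x. cell h x = cell h x0} \<le> emeasure lborel (cball x0 (real DIM('a) * h))"
    by (intro emeasure_mono) auto
  also have "\<dots> < \<infinity>" by (rule emeasure_lborel_cball_finite)
  finally show fin: "emeasure lborel {x. cell h x = cell h x0} < \<infinity>" .
  define p where "p = h *\<^sub>R cell h x0"
  have sub: "box p (p + h *\<^sub>R One) \<subseteq> {x. cell h x = cell h x0}"
  proof
    fix x assume x: "x \<in> box p (p + h *\<^sub>R One)"
    have "\<lfloor>x \<bullet> b / h\<rfloor> = \<lfloor>x0 \<bullet> b / h\<rfloor>" if b: "b \<in> Basis" for b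
    proof -
      have "h * real_of_int \<lfloor>x0 \<bullet> b / h\<rfloor> < x \<bullet> b" "x \<bullet> b < h * real_of_int \<lfloor>x0 \<bullet> b / h\<rfloor> + h"
        using x b by (auto simp: mem_box p_def inner_add_left cell_inner)
      then have "real_of_int \<lfloor>x0 \<bullet> b / h\<rfloor> \<le> x \<bullet> b / h" "x \<bullet> b / h < real_of_int \<lfloor>x0 \<bullet> b / h\<rfloor> + 1"
        using h by (auto simp: field_simps)
      then show ?thesis by (rule floor_unique)
    qed
    then show "x \<in> {x. cell h x = cell h x0}" unfolding cell_def by simp
  qed
  have "h ^ DIM('a) = measure lborel (box p (p + h *\<^sub>R One))"
    using h by (subst measure_lborel_box_eq) (auto simp: inner_add_left)
  also have "\<dots> \<le> measure lborel {x. cell h x = cell h x0}"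
    using fin by (intro measure_mono_fmeasurable[OF sub] fmeasurableI) auto
  finally show "h ^ DIM('a) \<le> measure lborel {x. cell h x = cell h x0}" .
qed

text \<open>The variance identity turns the distance of \<open>w\<close> to its average on \<open>C\<close> into a double integral.\<close>

lemma
  fixes w :: "'a::euclidean_space \<Rightarrow> real"
  assumes [measurable]: "C \<in> sets borel" "w \<in> borel_measurable lborel"
    and C: "emeasure lborel C < \<infinity>" and w: "integrable lborel (\<lambda>x. (w x)\<^sup>2)"
  shows integrable_square_diff_set:
      "integrable (lborel \<Otimes>\<^sub>M lborel) (\<lambda>(x, y). indicator C x * indicator C y * (w x - w y)\<^sup>2)"
    and variance_identity: "measure lborel C * (LINT x|lborel. indicator C x * (w x)\<^sup>2) =
      (LINT x|lborel. indicator C x * w x)\<^sup>2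
      + (LINT z|(lborel \<Otimes>\<^sub>M lborel). (\<lambda>(x, y). indicator C x * indicator C y * (w x - w y)\<^sup>2) z) / 2"
proof -
  define e where "e = (\<lambda>x. indicator C x :: real)"
  have e[measurable]: "e \<in> borel_measurable lborel" unfolding e_def by measurable
  have ee: "e x * e x = e x" for x unfolding e_def by (simp add: indicator_def)
  have ie: "integrable lborel e" unfolding e_def using C by (intro integrable_real_indicator) auto
  have ie2: "integrable lborel (\<lambda>x. e x * (w x)\<^sup>2)"
    by (rule Bochner_Integration.integrable_bound[OF w]) (auto simp: e_def indicator_def)
  have iew: "integrable lborel (\<lambda>x. e x * w x)"
    using integrable_mult_L2[of e lborel w] ie w ee by (simp add: power2_eq_square)
  note p1 = integrable_pair_mult[OF ie2 ie] and p2 = integrable_pair_mult[OF ie ie2]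
    and p3 = integrable_pair_mult[OF iew iew]
  \<comment> \<open>After expanding the square, each term is a product of a function of
    \<open>x\<close> and a function of \<open>y\<close>, so its double integral factorises.\<close>
  have eq: "(\<lambda>(x, y). indicator C x * indicator C y * (w x - w y)\<^sup>2)
    = (\<lambda>z. (\<lambda>(x, y). e x * (w x)\<^sup>2 * e y) z + (\<lambda>(x, y). e x * (e y * (w y)\<^sup>2)) z
        - 2 * (\<lambda>(x, y). e x * w x * (e y * w y)) z)"
    by (auto simp: fun_eq_iff e_def[symmetric] power2_eq_square algebra_simps)
  show "integrable (lborel \<Otimes>\<^sub>M lborel) (\<lambda>(x, y). indicator C x * indicator C y * (w x - w y)\<^sup>2)"
    unfolding eq by (intro Bochner_Integration.integrable_diff Bochner_Integration.integrable_add
      integrable_mult_right p1 p2 p3)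
  have "(LINT z|(lborel \<Otimes>\<^sub>M lborel). (\<lambda>(x, y). indicator C x * indicator C y * (w x - w y)\<^sup>2) z)
    = integral\<^sup>L lborel (\<lambda>x. e x * (w x)\<^sup>2) * integral\<^sup>L lborel e
      + integral\<^sup>L lborel e * integral\<^sup>L lborel (\<lambda>x. e x * (w x)\<^sup>2)
      - 2 * (integral\<^sup>L lborel (\<lambda>x. e x * w x) * integral\<^sup>L lborel (\<lambda>x. e x * w x))"
    unfolding eq integral_pair_mult[OF ie2 ie, symmetric] integral_pair_mult[OF ie ie2, symmetric]
      integral_pair_mult[OF iew iew, symmetric]
    by (subst Bochner_Integration.integral_diff Bochner_Integration.integral_add,
      (intro Bochner_Integration.integrable_diff Bochner_Integration.integrable_add
      integrable_mult_right p1 p2 p3)+)+ (simp only: integral_mult_right_zero)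
  moreover have "integral\<^sup>L lborel e = measure lborel C" unfolding e_def by simp
  ultimately show "measure lborel C * (LINT x|lborel. indicator C x * (w x)\<^sup>2) =
      (LINT x|lborel. indicator C x * w x)\<^sup>2
      + (LINT z|(lborel \<Otimes>\<^sub>M lborel). (\<lambda>(x, y). indicator C x * indicator C y * (w x - w y)\<^sup>2) z) / 2"
    by (simp add: e_def[symmetric] power2_eq_square field_simps)
qed

text \<open>A Poincare inequality on each cell, summed over the grid. On the square of a cell the
  distance is at most \<open>DIM('a) * h\<close>, so the missing weight costs a factor of order h^(N
  + 2r), where N is the dimension. Dividing by the volume, at least h^N, leaves h^(2r), which tends
  to 0 with \<open>h\<close>. The squares of distinct cells are disjoint, so one Gagliardo integral
  pays for all of them.\<close>

lemma L2_le_cell_averages: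
  fixes w :: "'a::euclidean_space \<Rightarrow> real"
  assumes w: "w \<in> X0 \<Omega> r" and \<Omega>: "bounded \<Omega>" and r: "0 < r" and h: "0 < h"
  shows "(LINT x|lborel. (w x)\<^sup>2) \<le>
    (\<Sum>c\<in>cell h ` \<Omega>. (LINT x|lborel. indicator {x. cell h x = c} x * w x)\<^sup>2) / h ^ DIM('a)
    + real DIM('a) powr (real DIM('a) + 2 * r) / 2 * h powr (2 * r)
      * integral\<^sup>L (lborel \<Otimes>\<^sub>M lborel) (gagliardo_form r w w)"
proof -
  define N where "N = real DIM('a)"
  have N: "N > 0" unfolding N_def by simp
  define G where "G = cell h ` \<Omega>"
  have G: "finite G" unfolding G_def by (rule finite_cell_image[OF \<Omega> h])
  define E where "E = (\<lambda>c (x::'a). indicator {x. cell h x = c} x :: real)"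
  have E[measurable]: "E c \<in> borel_measurable lborel" for c unfolding E_def by measurable
  have [measurable]: "w \<in> borel_measurable lborel" and w2: "integrable lborel (\<lambda>x. (w x)\<^sup>2)"
    and gi: "integrable (lborel \<Otimes>\<^sub>M lborel) (gagliardo_form r w w)"
    and w0: "AE x in lborel. x \<notin> \<Omega> \<longrightarrow> w x = 0"
    using w by (auto simp: X0_iff)
  have Ei: "integrable lborel (\<lambda>x. E c x * (w x)\<^sup>2)" for c
    by (rule Bochner_Integration.integrable_bound[OF w2]) (auto simp: E_def indicator_def)
  define F where "F = (\<lambda>c (x, y). E c x * E c y * (w x - w y)\<^sup>2)"
  have fin: "emeasure lborel {x. cell h x = c} < \<infinity>" if "c \<in> G" for c
    using that emeasure_cell_finite[OF h] unfolding G_def by blast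
  have Fi: "integrable (lborel \<Otimes>\<^sub>M lborel) (F c)" if "c \<in> G" for c
    using integrable_square_diff_set[of "{x. cell h x = c}" w] fin[OF that] w2 unfolding F_def E_def by simp
  define D where "D = (N * h) powr (N + 2 * r)"
  have D: "D \<ge> 0" unfolding D_def by simp
  \<comment> \<open>Each point of \<open>\<Omega>\<close> lies in exactly one cell of
    \<open>G\<close>, and \<open>w\<close> vanishes almost everywhere outside
    \<open>\<Omega>\<close>.\<close>
  have "(LINT x|lborel. (w x)\<^sup>2) = (LINT x|lborel. (\<Sum>c\<in>G. E c x * (w x)\<^sup>2))"
  proof (rule integral_cong_AE)
    show "AE x in lborel. (w x)\<^sup>2 = (\<Sum>c\<in>G. E c x * (w x)\<^sup>2)"
      using w0
    proof eventually_elim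
      case (elim x)
      show ?case
      proof (cases "x \<in> \<Omega>")
        case True
        then have "(\<Sum>c\<in>G. E c x) = 1"
          using G by (simp add: E_def indicator_def G_def)
        then show ?thesis by (simp add: sum_distrib_right[symmetric])
      qed (use elim in simp)
    qed
  qed measurable
  also have "\<dots> = (\<Sum>c\<in>G. LINT x|lborel. E c x * (w x)\<^sup>2)"
    using Ei by (intro Bochner_Integration.integral_sum) auto
  also have "\<dots> \<le> (\<Sum>c\<in>G. ((LINT x|lborel. E c x * w x)\<^sup>2 + integral\<^sup>L (lborel \<Otimes>\<^sub>M lborel) (F c) / 2) / h ^ DIM('a))"
  proof (rule sum_mono)
    fix c assume c: "c \<in> G"
    then obtain x0 where x0: "c = cell h x0" unfolding G_def by auto
    have "h ^ DIM('a) * (LINT x|lborel. E c x * (w x)\<^sup>2)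
      \<le> measure lborel {x. cell h x = c} * (LINT x|lborel. E c x * (w x)\<^sup>2)"
      unfolding x0 by (intro mult_right_mono measure_cell_ge[OF h] Bochner_Integration.integral_nonneg)
        (auto simp: E_def)
    also have "\<dots> = (LINT x|lborel. E c x * w x)\<^sup>2 + integral\<^sup>L (lborel \<Otimes>\<^sub>M lborel) (F c) / 2"
      using variance_identity[of "{x. cell h x = c}" w] fin[OF c] w2 unfolding E_def F_def by simp
    finally show "(LINT x|lborel. E c x * (w x)\<^sup>2)
       \<le> ((LINT x|lborel. E c x * w x)\<^sup>2 + integral\<^sup>L (lborel \<Otimes>\<^sub>M lborel) (F c) / 2) / h ^ DIM('a)"
      using h by (simp add: field_simps)
  qed
  also have "\<dots> = (\<Sum>c\<in>G. (LINT x|lborel. E c x * w x)\<^sup>2) / h ^ DIM('a)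
      + (\<Sum>c\<in>G. integral\<^sup>L (lborel \<Otimes>\<^sub>M lborel) (F c)) / (2 * h ^ DIM('a))"
    by (simp add: sum_divide_distrib[symmetric] sum.distrib add_divide_distrib)
  also have "(\<Sum>c\<in>G. integral\<^sup>L (lborel \<Otimes>\<^sub>M lborel) (F c))
      = integral\<^sup>L (lborel \<Otimes>\<^sub>M lborel) (\<lambda>z. \<Sum>c\<in>G. F c z)"
    using Fi by (intro Bochner_Integration.integral_sum[symmetric]) auto
  also have "\<dots> \<le> integral\<^sup>L (lborel \<Otimes>\<^sub>M lborel) (\<lambda>z. D * gagliardo_form r w w z)"
  proof (rule integral_mono)
    show "integrable (lborel \<Otimes>\<^sub>M lborel) (\<lambda>z. \<Sum>c\<in>G. F c z)"
      using Fi by (intro Bochner_Integration.integrable_sum) auto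
    show "integrable (lborel \<Otimes>\<^sub>M lborel) (\<lambda>z. D * gagliardo_form r w w z)"
      using gi by (rule integrable_mult_right)
    fix z :: "'a \<times> 'a"
    obtain x y where z: "z = (x, y)" by (cases z)
    \<comment> \<open>At most the cell of \<open>x\<close> contributes. It may be missing from
      \<open>G\<close> when \<open>x\<close> is outside \<open>\<Omega>\<close>, which is why the
      next step is an inequality.\<close>
    have "(\<Sum>c\<in>G. F c z) = (\<Sum>c\<in>G. if c = cell h x then (if cell h y = cell h x then (w x - w y)\<^sup>2 else 0) else 0)"
      unfolding z F_def E_def by (intro sum.cong) (auto simp: indicator_def)
    also have "\<dots> \<le> (if cell h y = cell h x then (w x - w y)\<^sup>2 else 0)"
      using G by (simp add: sum.delta)
    also have "\<dots> \<le> D * gagliardo_form r w w z"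
    \<comment> \<open>On the diagonal the kernel has the default value 0 and cannot be divided out;
      there the left side is 0 as well.\<close>
    proof (cases "cell h y = cell h x \<and> x \<noteq> y")
      case True
      have "norm (x - y) powr (N + 2 * r) \<le> D"
        unfolding D_def using norm_diff_cell[OF h, of x y] True N r by (intro powr_mono2) (auto simp: N_def)
      then have "(w x - w y)\<^sup>2 * norm (x - y) powr (N + 2 * r) \<le> (w x - w y)\<^sup>2 * D"
        by (intro mult_left_mono) auto
      moreover have "0 < norm (x - y) powr (N + 2 * r)" using True by simp
      ultimately have "(w x - w y)\<^sup>2 \<le> D * (w x - w y)\<^sup>2 / norm (x - y) powr (N + 2 * r)"
        by (simp add: pos_le_divide_eq mult.commute)
      then show ?thesis using True by (simp add: z gagliardo_form_def N_def power2_eq_square)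
    next
      case False
      then show ?thesis using D gagliardo_form_self_nonneg[of r w z] by auto
    qed
    finally show "(\<Sum>c\<in>G. F c z) \<le> D * gagliardo_form r w w z" .
  qed
  also have "\<dots> = D * integral\<^sup>L (lborel \<Otimes>\<^sub>M lborel) (gagliardo_form r w w)" by simp
  also have "D * integral\<^sup>L (lborel \<Otimes>\<^sub>M lborel) (gagliardo_form r w w) / (2 * h ^ DIM('a))
    = N powr (N + 2 * r) / 2 * h powr (2 * r) * integral\<^sup>L (lborel \<Otimes>\<^sub>M lborel) (gagliardo_form r w w)"
  proof -
    have "D = N powr (N + 2 * r) * (h ^ DIM('a) * h powr (2 * r))"
      unfolding D_def using h N by (simp add: powr_mult powr_add powr_realpow N_def)
    then show ?thesis using h by simp
  qed
  finally show ?thesis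
    using h by (simp add: divide_right_mono G_def E_def N_def)
qed

text \<open>Parallelogram identity with the seminorm of the sum discarded.\<close>

lemma X0_inner_diff_le:
  fixes u :: "'a::euclidean_space \<Rightarrow> real"
  assumes u: "u \<in> X0 \<Omega> r" and v: "v \<in> X0 \<Omega> r" and r: "0 < r" "r < 1"
  shows "X0_inner r (\<lambda>x. u x - v x) (\<lambda>x. u x - v x) \<le> 2 * X0_inner r u u + 2 * X0_inner r v v"
  using X0_inner_add_scaled[OF u v, of "-1"] X0_inner_add_scaled[OF u v, of 1]
    X0_inner_nonneg[OF r, of "\<lambda>x. u x + v x"] by simp

lemma X0_diff: "u \<in> X0 \<Omega> r \<Longrightarrow> v \<in> X0 \<Omega> r \<Longrightarrow> (\<lambda>x. u x - v x) \<in> X0 \<Omega> r"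
  using X0_add_scaled[of u \<Omega> r v "-1"] by simp

text \<open>On \<open>\<Omega>\<close> the bound |t| \<le> 1 + t^2 stands in for Cauchy-Schwarz. The
  result does not depend on \<open>C\<close>, so it serves all cells of all meshes at once, as the
  diagonal argument requires.\<close>

lemma abs_integral_cell_le:
  fixes u :: "'a::euclidean_space \<Rightarrow> real"
  assumes u: "u \<in> X0 \<Omega> r" and \<Omega>: "bounded \<Omega>" "open \<Omega>" and [measurable]: "C \<in> sets borel"
  shows "\<bar>LINT x|lborel. indicator C x * u x\<bar> \<le> measure lborel \<Omega> + (LINT x|lborel. (u x)\<^sup>2)"
    and "integrable lborel (\<lambda>x. indicator C x * u x)"
proof -
  have [measurable]: "u \<in> borel_measurable lborel" and u2: "integrable lborel (\<lambda>x. (u x)\<^sup>2)"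
    and u0: "AE x in lborel. x \<notin> \<Omega> \<longrightarrow> u x = 0" using u by (auto simp: X0_iff)
  have [measurable]: "\<Omega> \<in> sets borel" using \<Omega>(2) by simp
  have i: "integrable lborel (indicator \<Omega> :: 'a \<Rightarrow> real)"
    using emeasure_bounded_finite[OF \<Omega>(1)] by (intro integrable_real_indicator) auto
  have ii: "integrable lborel (\<lambda>x. indicator \<Omega> x + (u x)\<^sup>2)"
    using i u2 by (rule Bochner_Integration.integrable_add)
  have ae: "AE x in lborel. norm (indicator C x * u x) \<le> norm (indicator \<Omega> x + (u x)\<^sup>2)"
    using u0
  proof eventually_elim
    case (elim x)
    have "\<bar>u x\<bar> \<le> 1 + (u x)\<^sup>2" using abs_mult_le_squares[of 1 "u x"] by simp
    then show ?case using elim by (auto simp: indicator_def)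
  qed
  show iC: "integrable lborel (\<lambda>x. indicator C x * u x)"
    by (rule Bochner_Integration.integrable_bound[OF ii _ ae]) measurable
  have "\<bar>LINT x|lborel. indicator C x * u x\<bar> \<le> (LINT x|lborel. \<bar>indicator C x * u x\<bar>)"
    by (rule integral_abs_bound)
  also have "\<dots> \<le> (LINT x|lborel. indicator \<Omega> x + (u x)\<^sup>2)"
    using ae iC ii by (intro integral_mono_AE integrable_abs) auto
  also have "\<dots> = measure lborel \<Omega> + (LINT x|lborel. (u x)\<^sup>2)"
    using i u2 by (simp add: Bochner_Integration.integral_add)
  finally show "\<bar>LINT x|lborel. indicator C x * u x\<bar> \<le> measure lborel \<Omega> + (LINT x|lborel. (u x)\<^sup>2)" .
qed

text \<open>The pairs of a mesh and one of its cells form a countable set, and the cell integrals of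
  \<open>u n\<close> are uniformly bounded functions on it. The diagonal argument
  \<open>function_convergent_subsequence\<close> makes all of them converge along one subsequence.
  Given \<open>e\<close>, the mesh is fixed first, to make the seminorm term small uniformly in the
  indices; then only finitely many convergent sequences remain.\<close>

lemma X0_L2_Cauchy_subseq:
  fixes u :: "nat \<Rightarrow> 'a::euclidean_space \<Rightarrow> real"
  assumes \<Omega>: "bounded \<Omega>" "open \<Omega>" and r: "0 < r" "r < 1"
    and u: "\<And>n. u n \<in> X0 \<Omega> r"
    and M1: "\<And>n. (LINT x|lborel. (u n x)\<^sup>2) \<le> M" and M2: "\<And>n. X0_inner r (u n) (u n) \<le> M"
  obtains s :: "nat \<Rightarrow> nat" where "strict_mono s"
    "\<And>e. 0 < e \<Longrightarrow> \<exists>N. \<forall>m\<ge>N. \<forall>n\<ge>N. (LINT x|lborel. (u (s m) x - u (s n) x)\<^sup>2) < e"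
proof -
  define h where "h = (\<lambda>k::nat. 1 / real (Suc k))"
  have h: "h k > 0" for k unfolding h_def by simp
  define S where "S = (SIGMA k:UNIV. cell (h k) ` \<Omega>)"
  have S: "countable S"
    unfolding S_def using finite_cell_image[OF \<Omega>(1) h] by (intro countable_SIGMA) (auto intro: countable_finite)
  define a where "a = (\<lambda>n (k, c). LINT x|lborel. indicator {x. cell (h k) x = c} x * u n x)"
  have "norm (a n p) \<le> measure lborel \<Omega> + M" for n p
    using abs_integral_cell_le(1)[OF u \<Omega>, of "{x. cell (h (fst p)) x = snd p}" n] M1[of n]
    by (simp add: a_def case_prod_beta)
  then obtain s :: "nat \<Rightarrow> nat" where s: "strict_mono s" and
    conv: "\<And>p. p \<in> S \<Longrightarrow> \<exists>l. (\<lambda>n. a (s n) p) \<longlonglongrightarrow> l"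
    using function_convergent_subsequence[OF S, of a "measure lborel \<Omega> + M"] by metis
  define \<kappa> where "\<kappa> = fl_const TYPE('a) r / 2"
  have \<kappa>: "\<kappa> > 0" unfolding \<kappa>_def using fl_const_pos[OF r, where 'a='a] by simp
  have M0: "M \<ge> 0" using X0_inner_nonneg[OF r, of "u 0"] M2[of 0] by simp
  define N where "N = real DIM('a) powr (real DIM('a) + 2 * r) / 2"
  show thesis
  proof (rule that[OF s])
    fix e :: real assume e: "0 < e"
    \<comment> \<open>The number \<open>4 * M / \<kappa>\<close> bounds the Gagliardo integral of
      any difference of two members of the sequence.\<close>
    have "(\<lambda>k. N * h k powr (2 * r) * (4 * M / \<kappa>)) \<longlonglongrightarrow> N * 0 powr (2 * r) * (4 * M / \<kappa>)"
      unfolding h_def using r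
      by (intro tendsto_intros tendsto_powr2 lim_1_over_n LIMSEQ_Suc[OF lim_1_over_n]) auto
    then have "(\<lambda>k. N * h k powr (2 * r) * (4 * M / \<kappa>)) \<longlonglongrightarrow> 0" by simp
    from order_tendstoD(2)[OF this, of "e / 2"] e obtain k where
      k: "N * h k powr (2 * r) * (4 * M / \<kappa>) < e / 2"
      by (auto simp: eventually_sequentially)
    define G where "G = cell (h k) ` \<Omega>"
    have "\<exists>l. (\<lambda>n. a (s n) (k, c)) \<longlonglongrightarrow> l" if "c \<in> G" for c
      by (rule conv) (use that in \<open>auto simp: S_def G_def\<close>)
    then obtain l where l: "\<And>c. c \<in> G \<Longrightarrow> (\<lambda>n. a (s n) (k, c)) \<longlonglongrightarrow> l c" by metis
    define F where "F = (\<lambda>p. (\<Sum>c\<in>G. (a (s (fst p)) (k, c) - a (s (snd p)) (k, c))\<^sup>2) / h k ^ DIM('a))"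
    \<comment> \<open>The Cauchy property is a double limit, taken along the product filter.\<close>
    have "(F \<longlongrightarrow> (\<Sum>c\<in>G. (l c - l c)\<^sup>2) / h k ^ DIM('a)) (sequentially \<times>\<^sub>F sequentially)"
      unfolding F_def
    proof (intro tendsto_intros)
      fix c assume c: "c \<in> G"
      show "((\<lambda>p. a (s (fst p)) (k, c)) \<longlongrightarrow> l c) (sequentially \<times>\<^sub>F sequentially)"
        by (rule filterlim_compose[OF l[OF c] filterlim_fst])
      show "((\<lambda>p. a (s (snd p)) (k, c)) \<longlongrightarrow> l c) (sequentially \<times>\<^sub>F sequentially)"
        by (rule filterlim_compose[OF l[OF c] filterlim_snd])
    qed (use h[of k] in auto)
    then have "(F \<longlongrightarrow> 0) (sequentially \<times>\<^sub>F sequentially)" by simp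
    from order_tendstoD(2)[OF this, of "e / 2"] e obtain N0 where
      N0: "\<And>m n. m \<ge> N0 \<Longrightarrow> n \<ge> N0 \<Longrightarrow> F (m, n) < e / 2"
      by (auto simp: eventually_prod_sequentially)
    show "\<exists>N. \<forall>m\<ge>N. \<forall>n\<ge>N. (LINT x|lborel. (u (s m) x - u (s n) x)\<^sup>2) < e"
    proof (intro exI allI impI)
      fix m n assume mn: "N0 \<le> m" "N0 \<le> n"
      define w where "w = (\<lambda>x. u (s m) x - u (s n) x)"
      have w: "w \<in> X0 \<Omega> r" unfolding w_def by (intro X0_diff u)
      have "X0_inner r w w \<le> 4 * M"
        using X0_inner_diff_le[OF u[of "s m"] u[of "s n"] r] M2[of "s m"] M2[of "s n"] unfolding w_def by simp
      then have gw: "integral\<^sup>L (lborel \<Otimes>\<^sub>M lborel) (gagliardo_form r w w) \<le> 4 * M / \<kappa>"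
        using \<kappa> unfolding X0_inner_def \<kappa>_def[symmetric] by (simp add: pos_le_divide_eq mult.commute)
      have av: "(LINT x|lborel. indicator {x. cell (h k) x = c} x * w x) = a (s m) (k, c) - a (s n) (k, c)" for c
        unfolding w_def a_def right_diff_distrib prod.case
        by (intro Bochner_Integration.integral_diff abs_integral_cell_le(2)[OF u \<Omega>]) measurable
      have "(LINT x|lborel. (w x)\<^sup>2) \<le> F (m, n) + N * h k powr (2 * r) *
         integral\<^sup>L (lborel \<Otimes>\<^sub>M lborel) (gagliardo_form r w w)"
        using L2_le_cell_averages[OF w \<Omega>(1) r(1) h[of k]]
        unfolding av F_def G_def N_def fst_conv snd_conv .
      also have "N * h k powr (2 * r) * integral\<^sup>L (lborel \<Otimes>\<^sub>M lborel) (gagliardo_form r w w)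
        \<le> N * h k powr (2 * r) * (4 * M / \<kappa>)"
        using gw by (intro mult_left_mono) (auto simp: N_def)
      finally show "(LINT x|lborel. (u (s m) x - u (s n) x)\<^sup>2) < e"
        using N0[OF mn] k unfolding w_def by simp
    qed
  qed
qed

section \<open>Riesz-Fischer and the compact embedding\<close>

text \<open>The Riesz-Fischer argument. Besides the limit it records what the direct method
  consumes: almost everywhere convergence and convergence of the L^2 norms along the same
  subsequence.\<close>

lemma L2_complete:
  fixes f :: "nat \<Rightarrow> 'b \<Rightarrow> real"
  assumes f[measurable]: "\<And>n. f n \<in> borel_measurable M" and f2: "\<And>n. integrable M (\<lambda>x. (f n x)\<^sup>2)"
    and Cauchy: "\<And>e. 0 < e \<Longrightarrow> \<exists>N. \<forall>m\<ge>N. \<forall>n\<ge>N. (LINT x|M. (f m x - f n x)\<^sup>2) < e"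
  obtains t :: "nat \<Rightarrow> nat" and v where "strict_mono t" "v \<in> borel_measurable M"
    "integrable M (\<lambda>x. (v x)\<^sup>2)" "AE x in M. (\<lambda>k. f (t k) x) \<longlonglongrightarrow> v x"
    "(\<lambda>k. LINT x|M. (f (t k) x)\<^sup>2) \<longlonglongrightarrow> (LINT x|M. (v x)\<^sup>2)"
proof -
  have sq: "integrable M (\<lambda>x. (g x - g' x)\<^sup>2)"
    if [measurable]: "g \<in> borel_measurable M" "g' \<in> borel_measurable M"
      and "integrable M (\<lambda>x. (g x)\<^sup>2)" "integrable M (\<lambda>x. (g' x)\<^sup>2)" for g g' :: "'b \<Rightarrow> real"
  proof -
    have "integrable M (\<lambda>x. (g x)\<^sup>2 + (g' x)\<^sup>2 - 2 * (g x * g' x))"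
      using that integrable_mult_L2[of g M g'] by auto
    then show ?thesis by (simp add: power2_diff mult.assoc)
  qed
  \<comment> \<open>The rate 1/4^k leaves room for a weight 2^k: the weighted squares of the
    increments still have integrals at most 1/2^k.\<close>
  have "\<exists>N. \<forall>m\<ge>N. \<forall>n\<ge>N. (LINT x|M. (f m x - f n x)\<^sup>2) < (1/4) ^ k" for k :: nat
    by (rule Cauchy) simp
  then obtain N where N: "\<And>k m n. m \<ge> N k \<Longrightarrow> n \<ge> N k \<Longrightarrow> (LINT x|M. (f m x - f n x)\<^sup>2) < (1/4) ^ k"
    by metis
  \<comment> \<open>The partial sums give strict growth and \<open>N k \<le> t k\<close> at
    once.\<close>
  define t where "t = (\<lambda>k. \<Sum>i\<le>k. Suc (N i))"
  have t: "strict_mono t" unfolding strict_mono_Suc_iff t_def by simp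
  have tN: "N k \<le> t k" for k
    unfolding t_def by (cases k) auto
  have tt: "(LINT x|M. (f (t k) x - f (t m) x)\<^sup>2) < (1/4) ^ k" if "k \<le> m" for k m
    using tN[of k] strict_mono_less_eq[OF t, of k m] that by (intro N) auto
  define d where "d = (\<lambda>k x. f (t (Suc k)) x - f (t k) x)"
  have [measurable]: "d k \<in> borel_measurable M" for k unfolding d_def by measurable
  have d2: "integrable M (\<lambda>x. (d k x)\<^sup>2)" for k
    unfolding d_def by (intro sq f f2)
  have dk: "(LINT x|M. (d k x)\<^sup>2) \<le> (1/4) ^ k" for k
    using tt[of k "Suc k"] unfolding d_def by (simp add: power2_commute)
  have "(\<integral>\<^sup>+x. (\<Sum>k. ennreal (2 ^ k * (d k x)\<^sup>2)) \<partial>M) = (\<Sum>k. \<integral>\<^sup>+x. ennreal (2 ^ k * (d k x)\<^sup>2) \<partial>M)"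
    by (rule nn_integral_suminf) measurable
  also have "\<dots> \<le> (\<Sum>k. ennreal ((1/2) ^ k))"
  proof (intro suminf_le summableI)
    fix k
    have "(\<integral>\<^sup>+x. ennreal (2 ^ k * (d k x)\<^sup>2) \<partial>M) = ennreal (LINT x|M. 2 ^ k * (d k x)\<^sup>2)"
      using d2[of k] by (intro nn_integral_eq_integral) auto
    also have "\<dots> \<le> ennreal (2 ^ k * (1/4) ^ k)"
      using dk[of k] by (intro ennreal_leI) simp
    also have "2 ^ k * (1/4) ^ k = (1/2 :: real) ^ k" by (simp add: power_mult_distrib[symmetric])
    finally show "(\<integral>\<^sup>+x. ennreal (2 ^ k * (d k x)\<^sup>2) \<partial>M) \<le> ennreal ((1/2) ^ k)" .
  qed
  also have "\<dots> = ennreal (\<Sum>k. (1/2) ^ k)" by (rule suminf_ennreal2) (auto intro: summable_geometric)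
  finally have "(\<integral>\<^sup>+x. (\<Sum>k. ennreal (2 ^ k * (d k x)\<^sup>2)) \<partial>M) \<noteq> \<infinity>"
    by (metis ennreal_less_top infinity_ennreal_def less_irrefl order_le_less_trans)
  then have "AE x in M. (\<Sum>k. ennreal (2 ^ k * (d k x)\<^sup>2)) \<noteq> \<infinity>"
    by (intro nn_integral_PInf_AE) measurable
  then have conv: "AE x in M. convergent (\<lambda>k. f (t k) x)"
  proof eventually_elim
    case (elim x)
    then have "summable (\<lambda>k. 2 ^ k * (d k x)\<^sup>2)"
      by (intro summable_suminf_not_top) (auto simp: infinity_ennreal_def)
    moreover have "summable (\<lambda>k. (1/2 :: real) ^ k)" by (rule summable_geometric) simp
    ultimately have sm: "summable (\<lambda>k. (1/2) ^ k + 2 ^ k * (d k x)\<^sup>2)" by (intro summable_add)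
    \<comment> \<open>With the weight 2^k, summability of the squares passes to the increments
      themselves: |d| \<le> 2^(-k) + 2^k d^2.\<close>
    have nm: "norm (d k x) \<le> (1/2) ^ k + 2 ^ k * (d k x)\<^sup>2" for k
    proof -
      have "\<bar>1 * (2 ^ k * d k x)\<bar> \<le> 1\<^sup>2 + (2 ^ k * d k x)\<^sup>2" by (rule abs_mult_le_squares)
      then have "2 ^ k * \<bar>d k x\<bar> \<le> 2 ^ k * ((1/2) ^ k + 2 ^ k * (d k x)\<^sup>2)"
        by (simp add: abs_mult power_mult_distrib distrib_left power_one_over power2_eq_square
            mult.assoc mult.left_commute)
      then show ?thesis by (simp only: mult_le_cancel_left_pos zero_less_power zero_less_numeral real_norm_def)
    qed
    have "summable (\<lambda>k. d k x)" by (rule summable_comparison_test'[OF sm nm])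
    then have "convergent (\<lambda>k. f (t 0) x + (\<Sum>i<k. d i x))"
      by (intro convergent_add) (auto simp: summable_iff_convergent convergent_const)
    then show ?case unfolding d_def sum_lessThan_telescope[of "\<lambda>i. f (t i) x"] by simp
  qed
  define v where "v = (\<lambda>x. lim (\<lambda>k. f (t k) x))"
  have v[measurable]: "v \<in> borel_measurable M" unfolding v_def by measurable
  have lim: "AE x in M. (\<lambda>k. f (t k) x) \<longlonglongrightarrow> v x"
    using conv by eventually_elim (simp add: v_def convergent_LIMSEQ_iff)
  \<comment> \<open>Fatou's lemma in the second index turns the Cauchy bound into a bound on the
    distance to the limit.\<close>
  have key: "integrable M (\<lambda>x. (f (t k) x - v x)\<^sup>2) \<and> (LINT x|M. (f (t k) x - v x)\<^sup>2) \<le> (1/4) ^ k" for k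
  proof -
    have l: "AE x in M. (\<lambda>m. (f (t k) x - f (t (m + k)) x)\<^sup>2) \<longlonglongrightarrow> (f (t k) x - v x)\<^sup>2"
      using lim by eventually_elim (intro tendsto_intros LIMSEQ_ignore_initial_segment)
    have b: "(LINT x|M. (f (t k) x - f (t (m + k)) x)\<^sup>2) \<le> (1/4) ^ k" for m
      using tt[of k "m + k"] by simp
    have i: "integrable M (\<lambda>x. (f (t k) x - f (t (m + k)) x)\<^sup>2)" for m
      by (intro sq f f2)
    show ?thesis
      using integrable_of_bounded_AE_lim[OF i _ _ l b] integral_le_bound_AE_lim[OF i _ _ l b] by simp
  qed
  have "integrable M (\<lambda>x. (f (t 0) x - (f (t 0) x - v x))\<^sup>2)"
    by (rule sq) (use key[of 0] f2 in auto)
  then have v2: "integrable M (\<lambda>x. (v x)\<^sup>2)" by simp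
  define V where "V = (LINT x|M. (v x)\<^sup>2)"
  have bd: "norm ((LINT x|M. (f (t k) x)\<^sup>2) - V) \<le> (1/4) ^ k + 2 * (1/2) ^ k * (V + 1)" for k
  proof -
    define g where "g = (\<lambda>x. f (t k) x - v x)"
    have [measurable]: "g \<in> borel_measurable M" unfolding g_def by measurable
    have g2: "integrable M (\<lambda>x. (g x)\<^sup>2)" and gk: "(LINT x|M. (g x)\<^sup>2) \<le> (1/4) ^ k"
      using key[of k] unfolding g_def by auto
    have vg: "integrable M (\<lambda>x. v x * g x)" by (intro integrable_mult_L2 v2 g2) measurable
    have "(LINT x|M. (f (t k) x)\<^sup>2) = (LINT x|M. (v x)\<^sup>2 + (g x)\<^sup>2 + 2 * (v x * g x))"
      by (intro Bochner_Integration.integral_cong) (auto simp: g_def power2_eq_square algebra_simps)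
    also have "\<dots> = V + (LINT x|M. (g x)\<^sup>2) + 2 * (LINT x|M. v x * g x)"
      using v2 g2 vg by (simp add: V_def)
    finally have eq: "(LINT x|M. (f (t k) x)\<^sup>2) - V = (LINT x|M. (g x)\<^sup>2) + 2 * (LINT x|M. v x * g x)" by simp
    have "\<bar>LINT x|M. v x * g x\<bar> \<le> (LINT x|M. \<bar>v x * g x\<bar>)" by (rule integral_abs_bound)
    \<comment> \<open>The weights 2^(-k) and 2^k are balanced so that, with the integral of g^2 at
      most 4^(-k), both parts are of order 2^(-k).\<close>
    also have "\<dots> \<le> (LINT x|M. (1/2) ^ k * (v x)\<^sup>2 + 2 ^ k * (g x)\<^sup>2)"
    proof (rule integral_mono)
      fix x
      have "\<bar>v x * (2 ^ k * g x)\<bar> \<le> (v x)\<^sup>2 + (2 ^ k * g x)\<^sup>2" by (rule abs_mult_le_squares)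
      then have "2 ^ k * \<bar>v x * g x\<bar> \<le> 2 ^ k * ((1/2) ^ k * (v x)\<^sup>2 + 2 ^ k * (g x)\<^sup>2)"
        by (simp add: abs_mult power_mult_distrib distrib_left power_one_over power2_eq_square
            mult.assoc mult.left_commute)
      then show "\<bar>v x * g x\<bar> \<le> (1/2) ^ k * (v x)\<^sup>2 + 2 ^ k * (g x)\<^sup>2" by simp
    qed (use vg v2 g2 in auto)
    also have "\<dots> = (1/2) ^ k * V + 2 ^ k * (LINT x|M. (g x)\<^sup>2)"
      using v2 g2 by (simp add: V_def)
    also have "\<dots> \<le> (1/2) ^ k * V + 2 ^ k * (1/4) ^ k"
      using gk by simp
    also have "2 ^ k * (1/4) ^ k = (1/2 :: real) ^ k" by (simp add: power_mult_distrib[symmetric])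
    finally have "\<bar>LINT x|M. v x * g x\<bar> \<le> (1/2) ^ k * (V + 1)" by (simp add: distrib_left)
    moreover have "0 \<le> (LINT x|M. (g x)\<^sup>2)" by simp
    ultimately show ?thesis unfolding eq real_norm_def using gk by linarith
  qed
  have "(\<lambda>k. (1/4) ^ k + 2 * (1/2) ^ k * (V + 1)) \<longlonglongrightarrow> 0 + 2 * 0 * (V + 1)"
    by (intro tendsto_intros LIMSEQ_power_zero) simp_all
  then have "(\<lambda>k. (1/4) ^ k + 2 * (1/2) ^ k * (V + 1)) \<longlonglongrightarrow> 0" by simp
  from Lim_null_comparison[OF always_eventually[OF allI[OF bd]] this]
  have "(\<lambda>k. LINT x|M. (f (t k) x)\<^sup>2) \<longlonglongrightarrow> V" by (rule LIM_zero_cancel)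
  with t v v2 lim show thesis unfolding V_def by (rule that)
qed

text \<open>Convergence in the seminorm is not claimed: \<open>L\<close> is the limit of the
  seminorms, and lower semicontinuity gives only \<open>X0_inner r v v \<le> L\<close>. Naming
  \<open>L\<close> lets the minimisation pass to the limit in each term of the energy
  separately.\<close>

lemma X0_compact:
  fixes u :: "nat \<Rightarrow> 'a::euclidean_space \<Rightarrow> real"
  assumes \<Omega>: "bounded \<Omega>" "open \<Omega>" and r: "0 < r" "r < 1"
    and u: "\<And>n. u n \<in> X0 \<Omega> r"
    and M1: "\<And>n. (LINT x|lborel. (u n x)\<^sup>2) \<le> M" and M2: "\<And>n. X0_inner r (u n) (u n) \<le> M"
  obtains s :: "nat \<Rightarrow> nat" and v L where "strict_mono s" "v \<in> X0 \<Omega> r"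
    "AE x in lborel. (\<lambda>k. u (s k) x) \<longlonglongrightarrow> v x"
    "(\<lambda>k. LINT x|lborel. (u (s k) x)\<^sup>2) \<longlonglongrightarrow> (LINT x|lborel. (v x)\<^sup>2)"
    "(\<lambda>k. X0_inner r (u (s k)) (u (s k))) \<longlonglongrightarrow> L" "X0_inner r v v \<le> L"
proof -
  have um[measurable]: "u n \<in> borel_measurable lborel" and u2: "integrable lborel (\<lambda>x. (u n x)\<^sup>2)"
    and u0: "AE x in lborel. x \<notin> \<Omega> \<longrightarrow> u n x = 0" for n
    using u[of n] by (auto simp: X0_iff)
  obtain s1 :: "nat \<Rightarrow> nat" where s1: "strict_mono s1" and
    C: "\<And>e. 0 < e \<Longrightarrow> \<exists>N. \<forall>m\<ge>N. \<forall>n\<ge>N. (LINT x|lborel. (u (s1 m) x - u (s1 n) x)\<^sup>2) < e"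
    by (rule X0_L2_Cauchy_subseq[of \<Omega> r u M, OF \<Omega> r u M1 M2]) (rule that)
  obtain s2 :: "nat \<Rightarrow> nat" and v where s2: "strict_mono s2" and v[measurable]: "v \<in> borel_measurable lborel"
    and v2: "integrable lborel (\<lambda>x. (v x)\<^sup>2)"
    and lim: "AE x in lborel. (\<lambda>k. u (s1 (s2 k)) x) \<longlonglongrightarrow> v x"
    and lim2: "(\<lambda>k. LINT x|lborel. (u (s1 (s2 k)) x)\<^sup>2) \<longlonglongrightarrow> (LINT x|lborel. (v x)\<^sup>2)"
    by (rule L2_complete[of "\<lambda>n. u (s1 n)" lborel, OF um u2 C]) auto
  \<comment> \<open>A third extraction, so that the seminorms converge as numbers.\<close>
  have "bounded (range (\<lambda>k. X0_inner r (u (s1 (s2 k))) (u (s1 (s2 k)))))"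
    by (rule boundedI[of _ M]) (use M2 in \<open>auto simp: abs_of_nonneg[OF X0_inner_nonneg[OF r]]\<close>)
  then obtain L s3 where s3: "strict_mono (s3 :: nat \<Rightarrow> nat)"
    and L: "((\<lambda>k. X0_inner r (u (s1 (s2 k))) (u (s1 (s2 k)))) \<circ> s3) \<longlonglongrightarrow> L"
    using bounded_imp_convergent_subsequence by blast
  define s where "s = s1 \<circ> s2 \<circ> s3"
  have s: "strict_mono s" unfolding s_def by (intro strict_mono_o s1 s2 s3)
  have lims: "AE x in lborel. (\<lambda>k. u (s k) x) \<longlonglongrightarrow> v x"
    using lim
  proof eventually_elim
    case (elim x)
    from LIMSEQ_subseq_LIMSEQ[OF this s3] show ?case by (simp add: s_def o_def)
  qed
  have lim2s: "(\<lambda>k. LINT x|lborel. (u (s k) x)\<^sup>2) \<longlonglongrightarrow> (LINT x|lborel. (v x)\<^sup>2)"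
    using LIMSEQ_subseq_LIMSEQ[OF lim2 s3] by (simp add: s_def o_def)
  have Ls: "(\<lambda>k. X0_inner r (u (s k)) (u (s k))) \<longlonglongrightarrow> L"
    using L by (simp add: s_def o_def)
  define \<kappa> where "\<kappa> = fl_const TYPE('a) r / 2"
  have \<kappa>: "\<kappa> > 0" unfolding \<kappa>_def using fl_const_pos[OF r, where 'a='a] by simp
  have Lg: "(\<lambda>k. integral\<^sup>L (lborel \<Otimes>\<^sub>M lborel) (gagliardo_form r (u (s k)) (u (s k)))) \<longlonglongrightarrow> L / \<kappa>"
  proof -
    have "(\<lambda>k. X0_inner r (u (s k)) (u (s k)) / \<kappa>) \<longlonglongrightarrow> L / \<kappa>"
      using \<kappa> by (intro tendsto_divide Ls tendsto_const) auto
    then show ?thesis unfolding X0_inner_def \<kappa>_def[symmetric] using \<kappa> by simp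
  qed
  have lg: "AE z in lborel \<Otimes>\<^sub>M lborel. (\<lambda>k. gagliardo_form r (u (s k)) (u (s k)) z) \<longlonglongrightarrow> gagliardo_form r v v z"
    using AE_lborel_pair[OF lims]
  proof eventually_elim
    case (elim z)
    \<comment> \<open>The denominator does not depend on \<open>k\<close>; as an inverse factor it
      is a constant, also on the diagonal where it is 0.\<close>
    then show ?case unfolding gagliardo_form_def case_prod_beta divide_inverse
      by (intro tendsto_intros) auto
  qed
  note gi = X0_gagliardo_integrable[OF u u]
  have g1: "integrable (lborel \<Otimes>\<^sub>M lborel) (gagliardo_form r v v)"
    by (rule integrable_of_AE_lim[OF gi gagliardo_form_self_nonneg _ lg Lg]) measurable
  have g2: "integral\<^sup>L (lborel \<Otimes>\<^sub>M lborel) (gagliardo_form r v v) \<le> L / \<kappa>"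
    by (rule integral_le_AE_lim[OF gi gagliardo_form_self_nonneg _ lg Lg]) measurable
  have "AE x in lborel. \<forall>n. x \<notin> \<Omega> \<longrightarrow> u n x = 0"
    unfolding AE_all_countable using u0 by blast
  then have "AE x in lborel. x \<notin> \<Omega> \<longrightarrow> v x = 0"
    using lims
  proof eventually_elim
    case (elim x)
    show ?case
    proof
      assume "x \<notin> \<Omega>"
      then have "(\<lambda>k. u (s k) x) = (\<lambda>k. 0)" using elim(1) by auto
      with elim(2) have "(\<lambda>k. 0::real) \<longlonglongrightarrow> v x" by simp
      then show "v x = 0" using LIMSEQ_unique tendsto_const by blast
    qed
  qed
  then have "v \<in> X0 \<Omega> r" unfolding X0_iff using v2 g1 by simp
  moreover have "X0_inner r v v \<le> L"
    using g2 \<kappa> unfolding X0_inner_def \<kappa>_def[symmetric] by (simp add: pos_le_divide_eq mult.commute)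
  ultimately show thesis using s lims lim2s Ls by (intro that)
qed

subsection \<open>The first eigenvalue\<close>

text \<open>The direct method: the constraint survives because the L^2 norms converge, and the limit
  of a minimising sequence has seminorm at most the infimum. This identifies the value of
  \<open>LEAST\<close>.\<close>

lemma first_eigenvalue_attained:
  fixes \<Omega> :: "'a::euclidean_space set"
  assumes \<Omega>: "bounded \<Omega>" "open \<Omega>" "\<Omega> \<noteq> {}" and r: "0 < r" "r < 1"
  obtains v where "v \<in> X0 \<Omega> r" "(LINT x|lborel. (v x)\<^sup>2) = 1" "X0_inner r v v = first_eigenvalue \<Omega> r"
proof -
  define S where "S = {X0_inner r v v | v. v \<in> X0 \<Omega> r \<and> (LINT x|lborel. (v x)\<^sup>2) = 1}"
  have restr: "(LINT x:\<Omega>|lborel. (v x)\<^sup>2) = (LINT x|lborel. (v x)\<^sup>2)" if "v \<in> X0 \<Omega> r" for v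
    using that by (intro LINT_restrict_eq \<Omega>) (auto simp: X0_iff)
  have fe: "first_eigenvalue \<Omega> r = (LEAST c. c \<in> S)"
  proof -
    have "{X0_inner r v v | v. v \<in> X0 \<Omega> r \<and> sqrt (LINT x:\<Omega>|lborel. (v x)\<^sup>2) = 1} = S"
      unfolding S_def using restr by auto
    then show ?thesis unfolding first_eigenvalue_def by simp
  qed
  have S0: "0 \<le> c" if "c \<in> S" for c using that X0_inner_nonneg[OF r] unfolding S_def by auto
  have bdd: "bdd_below S" using S0 by (intro bdd_belowI[of _ 0])
  have ne: "S \<noteq> {}"
  proof -
    obtain v where "v \<in> X0 \<Omega> r" "(LINT x|lborel. (v x)\<^sup>2) = 1" by (rule X0_nontrivial[OF \<Omega>(2,3) r])
    then show ?thesis unfolding S_def by blast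
  qed
  define l where "l = Inf S"
  have "\<exists>v. v \<in> X0 \<Omega> r \<and> (LINT x|lborel. (v x)\<^sup>2) = 1 \<and> X0_inner r v v < l + 1 / real (Suc n)" for n
  proof -
    have "Inf S < l + 1 / real (Suc n)" unfolding l_def by simp
    then show ?thesis using cInf_lessD[OF ne, of "l + 1 / real (Suc n)"] unfolding S_def by auto
  qed
  then obtain u where u: "\<And>n. u n \<in> X0 \<Omega> r" and u1: "\<And>n. (LINT x|lborel. (u n x)\<^sup>2) = 1"
    and ul: "\<And>n. X0_inner r (u n) (u n) < l + 1 / real (Suc n)" by metis
  define M where "M = \<bar>l\<bar> + 1"
  have M1: "(LINT x|lborel. (u n x)\<^sup>2) \<le> M" for n unfolding u1 M_def by simp
  have M2: "X0_inner r (u n) (u n) \<le> M" for n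
  proof -
    have "1 / real (Suc n) \<le> 1" by simp
    then show ?thesis using ul[of n] unfolding M_def by linarith
  qed
  obtain s :: "nat \<Rightarrow> nat" and v L where s: "strict_mono s" and v: "v \<in> X0 \<Omega> r"
    and i: "(\<lambda>k. LINT x|lborel. (u (s k) x)\<^sup>2) \<longlonglongrightarrow> (LINT x|lborel. (v x)\<^sup>2)"
    and L: "(\<lambda>k. X0_inner r (u (s k)) (u (s k))) \<longlonglongrightarrow> L" and vL: "X0_inner r v v \<le> L"
    by (rule X0_compact[of \<Omega> r u M, OF \<Omega>(1,2) r u M1 M2])
  have v1: "(LINT x|lborel. (v x)\<^sup>2) = 1"
    using i unfolding u1 by (rule LIMSEQ_unique[OF _ tendsto_const])
  have "(\<lambda>k. l + 1 / real (Suc (s k))) \<longlonglongrightarrow> l + 0"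
    by (intro tendsto_intros filterlim_compose[OF LIMSEQ_Suc[OF lim_1_over_n] filterlim_subseq[OF s]])
  then have "(\<lambda>k. l + 1 / real (Suc (s k))) \<longlonglongrightarrow> l" by simp
  then have "L \<le> l" using less_imp_le[OF ul] by (intro LIMSEQ_le[OF L]) auto
  have vS: "X0_inner r v v \<in> S" unfolding S_def using v v1 by auto
  have lower: "X0_inner r v v \<le> c" if "c \<in> S" for c
    using cInf_lower[OF that bdd] vL \<open>L \<le> l\<close> unfolding l_def by linarith
  have "(LEAST c. c \<in> S) = X0_inner r v v"
    by (rule Least_equality[of "\<lambda>c. c \<in> S", OF vS lower])
  with v v1 show thesis by (intro that) (simp_all add: fe)
qed

subsection \<open>The energy functional\<close>

lemma Lp_iff:
  "v \<in> Lp p \<longleftrightarrow> v \<in> borel_measurable lborel \<and> integrable lborel (\<lambda>x. \<bar>v x\<bar> powr p)"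
  unfolding Lp_def by simp

lemma abs_add_powr_le:
  fixes a b p :: real
  assumes "0 \<le> p"
  shows "(\<bar>a\<bar> + \<bar>b\<bar>) powr p \<le> 2 powr p * (\<bar>a\<bar> powr p + \<bar>b\<bar> powr p)"
proof -
  have "(\<bar>a\<bar> + \<bar>b\<bar>) powr p \<le> (2 * max \<bar>a\<bar> \<bar>b\<bar>) powr p" using assms by (intro powr_mono2) auto
  also have "\<dots> = 2 powr p * (max \<bar>a\<bar> \<bar>b\<bar>) powr p" by (simp add: powr_mult)
  also have "\<dots> \<le> 2 powr p * (\<bar>a\<bar> powr p + \<bar>b\<bar> powr p)"
    by (intro mult_left_mono) (auto simp: max_def)
  finally show ?thesis .
qed

lemma Lp_add_scaled:
  fixes u v :: "'a::euclidean_space \<Rightarrow> real"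
  assumes u: "u \<in> Lp p" and v: "v \<in> Lp p" and p: "0 \<le> p"
  shows "(\<lambda>x. u x + t * v x) \<in> Lp p"
proof -
  have [measurable]: "u \<in> borel_measurable lborel" "v \<in> borel_measurable lborel"
    and i: "integrable lborel (\<lambda>x. \<bar>u x\<bar> powr p)" "integrable lborel (\<lambda>x. \<bar>v x\<bar> powr p)"
    using u v by (auto simp: Lp_iff)
  have i': "integrable lborel (\<lambda>x. 2 powr p * (\<bar>u x\<bar> powr p + \<bar>t\<bar> powr p * \<bar>v x\<bar> powr p))"
    using i by simp
  have "\<bar>u x + t * v x\<bar> powr p \<le> 2 powr p * (\<bar>u x\<bar> powr p + \<bar>t\<bar> powr p * \<bar>v x\<bar> powr p)" for x
  proof -
    have "\<bar>u x + t * v x\<bar> powr p \<le> (\<bar>u x\<bar> + \<bar>t * v x\<bar>) powr p" using p by (intro powr_mono2) auto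
    also have "\<dots> \<le> 2 powr p * (\<bar>u x\<bar> powr p + \<bar>t * v x\<bar> powr p)" by (rule abs_add_powr_le[OF p])
    finally show ?thesis by (simp add: abs_mult powr_mult)
  qed
  then have "integrable lborel (\<lambda>x. \<bar>u x + t * v x\<bar> powr p)"
    by (intro Bochner_Integration.integrable_bound[OF i']) auto
  then show ?thesis by (simp add: Lp_iff)
qed

lemma energy_space_add_scaled:
  "u \<in> energy_space \<Omega> \<sigma> p \<Longrightarrow> v \<in> energy_space \<Omega> \<sigma> p \<Longrightarrow> 0 \<le> p
    \<Longrightarrow> (\<lambda>x. u x + t * v x) \<in> energy_space \<Omega> \<sigma> p"
  unfolding energy_space_def using X0_add_scaled Lp_add_scaled by blast

lemma zero_in_energy_space: "(\<lambda>_. 0) \<in> energy_space \<Omega> \<sigma> p"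
  unfolding energy_space_def by (simp add: X0_zero Lp_iff)

text \<open>Meaningful on \<open>energy_space\<close>, where all three integrals converge; a
  divergent one would count as 0. The left side of the weak equation is its directional
  derivative.\<close>

definition energy :: "real \<Rightarrow> real \<Rightarrow> ('a::euclidean_space \<Rightarrow> real) \<Rightarrow> real" where
  "energy \<sigma> p u = X0_inner \<sigma> u u / 2 + (LINT x|lborel. \<bar>u x\<bar> powr p) / p - (LINT x|lborel. (u x)\<^sup>2) / 2"

text \<open>The threshold T = p^(1/(p-2)) solves T^(p-2) = p, so beyond it t^2 is at most |t|^p / p,
  and below it t^2 is at most T^2.\<close>

lemma square_le_powr:
  fixes t p :: real
  assumes p: "2 < p"
  shows "t\<^sup>2 \<le> (p powr (1 / (p - 2)))\<^sup>2 + \<bar>t\<bar> powr p / p"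
proof (cases "p powr (1 / (p - 2)) \<le> \<bar>t\<bar>")
  case True
  have "p = (p powr (1 / (p - 2))) powr (p - 2)" using p by (simp add: powr_powr)
  also have "\<dots> \<le> \<bar>t\<bar> powr (p - 2)" using True p by (intro powr_mono2) auto
  finally have "t\<^sup>2 * p \<le> t\<^sup>2 * \<bar>t\<bar> powr (p - 2)" by (intro mult_left_mono) auto
  also have "\<dots> = \<bar>t\<bar> powr p"
  proof -
    have "\<bar>t\<bar> powr p = \<bar>t\<bar> powr 2 * \<bar>t\<bar> powr (p - 2)" by (simp only: powr_add[symmetric]) simp
    then show ?thesis by simp
  qed
  finally have "t\<^sup>2 \<le> \<bar>t\<bar> powr p / p" using p by (simp add: pos_le_divide_eq)
  then show ?thesis by (simp add: add_increasing)
next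
  case False
  then have "\<bar>t\<bar>\<^sup>2 \<le> (p powr (1 / (p - 2)))\<^sup>2" by (intro power_mono) auto
  moreover have "0 \<le> \<bar>t\<bar> powr p / p" using p by simp
  ultimately show ?thesis by simp
qed

text \<open>The power term absorbs the whole of the integral of u^2, twice what the energy
  subtracts. The surplus half controls the L^2 norm, so the energy bounds both quantities that
  \<open>X0_compact\<close> asks for.\<close>

lemma energy_lower_bound:
  fixes u :: "'a::euclidean_space \<Rightarrow> real"
  assumes u: "u \<in> energy_space \<Omega> \<sigma> p" and \<Omega>: "bounded \<Omega>" "open \<Omega>" and p: "2 < p"
  shows "X0_inner \<sigma> u u / 2 + (LINT x|lborel. (u x)\<^sup>2) / 2
    \<le> energy \<sigma> p u + (p powr (1 / (p - 2)))\<^sup>2 * measure lborel \<Omega>"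
proof -
  define K where "K = (p powr (1 / (p - 2)))\<^sup>2"
  have u2: "integrable lborel (\<lambda>x. (u x)\<^sup>2)" and u0: "AE x in lborel. x \<notin> \<Omega> \<longrightarrow> u x = 0"
    and up: "integrable lborel (\<lambda>x. \<bar>u x\<bar> powr p)"
    using u by (auto simp: energy_space_def X0_iff Lp_iff)
  have [measurable]: "\<Omega> \<in> sets borel" using \<Omega>(2) by simp
  have i: "integrable lborel (indicator \<Omega> :: 'a \<Rightarrow> real)"
    using emeasure_bounded_finite[OF \<Omega>(1)] by (intro integrable_real_indicator) auto
  have "(LINT x|lborel. (u x)\<^sup>2) \<le> (LINT x|lborel. K * indicator \<Omega> x + \<bar>u x\<bar> powr p / p)"
  proof (rule integral_mono_AE[OF u2])
    show "integrable lborel (\<lambda>x. K * indicator \<Omega> x + \<bar>u x\<bar> powr p / p)" using i up by simp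
    show "AE x in lborel. (u x)\<^sup>2 \<le> K * indicator \<Omega> x + \<bar>u x\<bar> powr p / p"
      using u0
    proof eventually_elim
      case (elim x)
      then show ?case using square_le_powr[OF p, of "u x"] by (cases "x \<in> \<Omega>") (auto simp: K_def)
    qed
  qed
  also have "\<dots> = K * measure lborel \<Omega> + (LINT x|lborel. \<bar>u x\<bar> powr p) / p"
    using i up by simp
  finally show ?thesis unfolding energy_def K_def[symmetric] by linarith
qed

lemma energy_minimizer:
  fixes \<Omega> :: "'a::euclidean_space set"
  assumes \<Omega>: "bounded \<Omega>" "open \<Omega>" and \<sigma>: "0 < \<sigma>" "\<sigma> < 1" and p: "2 < p"
  obtains u where "u \<in> energy_space \<Omega> \<sigma> p"
    "\<And>w. w \<in> energy_space \<Omega> \<sigma> p \<Longrightarrow> energy \<sigma> p u \<le> energy \<sigma> p w"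
proof -
  define K where "K = (p powr (1 / (p - 2)))\<^sup>2 * measure lborel \<Omega>"
  define S where "S = energy \<sigma> p ` energy_space \<Omega> \<sigma> p"
  have low: "X0_inner \<sigma> u u / 2 + (LINT x|lborel. (u x)\<^sup>2) / 2 \<le> energy \<sigma> p u + K"
    if "u \<in> energy_space \<Omega> \<sigma> p" for u
    unfolding K_def by (rule energy_lower_bound[OF that \<Omega> p])
  have sq0: "0 \<le> (LINT x|lborel. (u x)\<^sup>2)" for u :: "'a \<Rightarrow> real" by simp
  note X0n = X0_inner_nonneg[OF \<sigma>, where 'a='a]
  have bdd: "bdd_below S"
  proof (rule bdd_belowI[of _ "- K"])
    fix c assume "c \<in> S"
    then obtain u where "u \<in> energy_space \<Omega> \<sigma> p" "c = energy \<sigma> p u" unfolding S_def by auto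
    then show "- K \<le> c" using low[of u] sq0[of u] X0n[of u] by linarith
  qed
  have ne: "S \<noteq> {}" unfolding S_def using zero_in_energy_space by blast
  define m where "m = Inf S"
  have "\<exists>u. u \<in> energy_space \<Omega> \<sigma> p \<and> energy \<sigma> p u < m + 1 / real (Suc n)" for n
  proof -
    have "Inf S < m + 1 / real (Suc n)" unfolding m_def by simp
    then show ?thesis using cInf_lessD[OF ne, of "m + 1 / real (Suc n)"] unfolding S_def by auto
  qed
  then obtain u where u: "\<And>n. u n \<in> energy_space \<Omega> \<sigma> p"
    and um: "\<And>n. energy \<sigma> p (u n) < m + 1 / real (Suc n)" by metis
  define M where "M = 2 * (m + 1 + K)"
  have b: "X0_inner \<sigma> (u n) (u n) / 2 + (LINT x|lborel. (u n x)\<^sup>2) / 2 \<le> m + 1 + K" for n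
  proof -
    have "1 / real (Suc n) \<le> 1" by simp
    then show ?thesis using um[of n] low[OF u[of n]] by linarith
  qed
  have aux: "y \<le> 2 * z" if "x / 2 + y / 2 \<le> z" "0 \<le> x" for x y z :: real
    using that by linarith
  have M1: "(LINT x|lborel. (u n x)\<^sup>2) \<le> M" for n
    using aux[OF b[of n] X0n] unfolding M_def .
  have M2: "X0_inner \<sigma> (u n) (u n) \<le> M" for n
    using aux[OF b[of n, unfolded add.commute[of "X0_inner _ _ _ / 2"]] sq0] unfolding M_def .
  have uX: "u n \<in> X0 \<Omega> \<sigma>" and up: "integrable lborel (\<lambda>x. \<bar>u n x\<bar> powr p)" for n
    using u[of n] by (auto simp: energy_space_def Lp_iff)
  obtain s :: "nat \<Rightarrow> nat" and v L where s: "strict_mono s" and v: "v \<in> X0 \<Omega> \<sigma>"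
    and ae: "AE x in lborel. (\<lambda>k. u (s k) x) \<longlonglongrightarrow> v x"
    and i: "(\<lambda>k. LINT x|lborel. (u (s k) x)\<^sup>2) \<longlonglongrightarrow> (LINT x|lborel. (v x)\<^sup>2)"
    and L: "(\<lambda>k. X0_inner \<sigma> (u (s k)) (u (s k))) \<longlonglongrightarrow> L" and vL: "X0_inner \<sigma> v v \<le> L"
    by (rule X0_compact[of \<Omega> \<sigma> u M, OF \<Omega>(1,2) \<sigma> uX M1 M2])
  have [measurable]: "v \<in> borel_measurable lborel" using v by (simp add: X0_iff)
  have "(\<lambda>k. m + 1 / real (Suc (s k))) \<longlonglongrightarrow> m + 0"
    by (intro tendsto_intros filterlim_compose[OF LIMSEQ_Suc[OF lim_1_over_n] filterlim_subseq[OF s]])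
  then have up_lim: "(\<lambda>k. m + 1 / real (Suc (s k))) \<longlonglongrightarrow> m" by simp
  have m_le: "m \<le> energy \<sigma> p w" if "w \<in> energy_space \<Omega> \<sigma> p" for w
    unfolding m_def by (rule cInf_lower[OF _ bdd]) (use that in \<open>auto simp: S_def\<close>)
  have Jm: "(\<lambda>k. energy \<sigma> p (u (s k))) \<longlonglongrightarrow> m"
    by (rule tendsto_sandwich[OF _ _ tendsto_const up_lim])
      (use m_le[OF u] less_imp_le[OF um] in auto)
  \<comment> \<open>The energy, the seminorm and the L^2 norm all converge, so solving the energy
    for its power term shows that this converges too, to \<open>Q\<close>. Fatou's lemma then puts
    \<open>v\<close> in L^p.\<close>
  define Q where "Q = p * (m - L / 2 + (LINT x|lborel. (v x)\<^sup>2) / 2)"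
  have "(\<lambda>k. p * (energy \<sigma> p (u (s k)) - X0_inner \<sigma> (u (s k)) (u (s k)) / 2
      + (LINT x|lborel. (u (s k) x)\<^sup>2) / 2)) \<longlonglongrightarrow> Q"
    unfolding Q_def by (intro tendsto_intros Jm L i) auto
  then have P: "(\<lambda>k. LINT x|lborel. \<bar>u (s k) x\<bar> powr p) \<longlonglongrightarrow> Q"
    unfolding energy_def using p by simp
  have aep: "AE x in lborel. (\<lambda>k. \<bar>u (s k) x\<bar> powr p) \<longlonglongrightarrow> \<bar>v x\<bar> powr p"
    using ae
  proof eventually_elim
    case (elim x)
    show ?case by (intro tendsto_powr' tendsto_rabs elim tendsto_const) (use p in auto)
  qed
  have vp: "integrable lborel (\<lambda>x. \<bar>v x\<bar> powr p)"
    by (rule integrable_of_AE_lim[OF up _ _ aep P]) auto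
  have vQ: "(LINT x|lborel. \<bar>v x\<bar> powr p) \<le> Q"
    by (rule integral_le_AE_lim[OF up _ _ aep P]) auto
  have vE: "v \<in> energy_space \<Omega> \<sigma> p"
    unfolding energy_space_def using v vp by (simp add: Lp_iff)
  have "(LINT x|lborel. \<bar>v x\<bar> powr p) / p \<le> m - L / 2 + (LINT x|lborel. (v x)\<^sup>2) / 2"
    using vQ p unfolding Q_def by (simp add: pos_divide_le_eq mult.commute)
  then have "energy \<sigma> p v \<le> m" unfolding energy_def using vL by linarith
  with m_le vE show thesis by (intro that[of v]) (auto intro: order_trans)
qed

text \<open>The competitor \<open>v\<close> need not lie in \<open>L\<^sup>p\<close>, so it is truncated first; then \<open>p > 2\<close> makes the energy of
  small multiples negative.\<close>

lemma energy_neg: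
  fixes \<Omega> :: "'a::euclidean_space set"
  assumes \<Omega>: "bounded \<Omega>" "open \<Omega>" and \<sigma>: "0 < \<sigma>" "\<sigma> < 1" and p: "2 < p"
    and v: "v \<in> X0 \<Omega> \<sigma>" "(LINT x|lborel. (v x)\<^sup>2) = 1" "X0_inner \<sigma> v v < 1"
  obtains w where "w \<in> energy_space \<Omega> \<sigma> p" "energy \<sigma> p w < 0"
proof -
  \<comment> \<open>Truncation at height \<open>k\<close> is 1-Lipschitz and fixes 0, so it does not
    increase the seminorm, while the L^2 norm recovers as \<open>k\<close> grows.\<close>
  define c where "c = (\<lambda>(k::nat) t::real. max (- real k) (min (real k) t))"
  have c[measurable]: "c k \<in> borel_measurable borel" for k unfolding c_def by measurable
  have c0: "c k 0 = 0" for k unfolding c_def by simp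
  have c1: "\<bar>c k a - c k b\<bar> \<le> \<bar>a - b\<bar>" for k a b unfolding c_def by (simp add: max_def min_def)
  have cb: "\<bar>c k a\<bar> \<le> real k" for k a unfolding c_def by (auto simp: abs_le_iff max_def min_def)
  have [measurable]: "v \<in> borel_measurable lborel" and v2: "integrable lborel (\<lambda>x. (v x)\<^sup>2)"
    and v0: "AE x in lborel. x \<notin> \<Omega> \<longrightarrow> v x = 0" using v(1) by (auto simp: X0_iff)
  have "(\<lambda>k. LINT x|lborel. (c k (v x))\<^sup>2) \<longlonglongrightarrow> (LINT x|lborel. (v x)\<^sup>2)"
  proof (rule integral_dominated_convergence[OF _ _ v2])
    show "AE x in lborel. (\<lambda>k. (c k (v x))\<^sup>2) \<longlonglongrightarrow> (v x)\<^sup>2"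
    proof (intro AE_I2)
      fix x
      obtain K :: nat where K: "\<bar>v x\<bar> \<le> real K" using real_arch_simple by blast
      have "c k (v x) = v x" if "k \<ge> K" for k
        using that K unfolding c_def by (auto simp: max_def min_def)
      then have "\<forall>\<^sub>F k in sequentially. (c k (v x))\<^sup>2 = (v x)\<^sup>2"
        unfolding eventually_sequentially by (intro exI[of _ K]) auto
      then show "(\<lambda>k. (c k (v x))\<^sup>2) \<longlonglongrightarrow> (v x)\<^sup>2" by (rule tendsto_eventually)
    qed
    show "AE x in lborel. norm ((c k (v x))\<^sup>2) \<le> (v x)\<^sup>2" for k
      using c1[of k _ 0] by (simp add: c0 abs_le_square_iff)
  qed measurable
  \<comment> \<open>The strict inequality between seminorm and L^2 norm leaves room for the
    truncation.\<close>
  from order_tendstoD(1)[OF this, of "X0_inner \<sigma> v v"] v obtain k where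
    k: "X0_inner \<sigma> v v < (LINT x|lborel. (c k (v x))\<^sup>2)"
    by (auto simp: eventually_sequentially)
  define w where "w = (\<lambda>x. c k (v x))"
  define E where "E = X0_inner \<sigma> w w"
  define I where "I = (LINT x|lborel. (w x)\<^sup>2)"
  define P where "P = (LINT x|lborel. \<bar>w x\<bar> powr p)"
  have wX: "w \<in> X0 \<Omega> \<sigma>" unfolding w_def by (rule X0_contraction[OF v(1) c c0 c1 \<sigma>])
  have "E \<le> X0_inner \<sigma> v v" unfolding E_def w_def by (rule X0_inner_contraction[OF v(1) c c0 c1 \<sigma>])
  with k have EI: "E < I" unfolding I_def w_def by linarith
  have [measurable]: "w \<in> borel_measurable lborel" unfolding w_def by measurable
  have [measurable]: "\<Omega> \<in> sets borel" using \<Omega>(2) by simp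
  have ind: "integrable lborel (\<lambda>x. real k powr p * indicator \<Omega> x :: real)"
    using emeasure_bounded_finite[OF \<Omega>(1)] by (intro integrable_mult_right integrable_real_indicator) auto
  have "integrable lborel (\<lambda>x. \<bar>w x\<bar> powr p)"
  proof (rule Bochner_Integration.integrable_bound[OF ind])
    show "AE x in lborel. norm (\<bar>w x\<bar> powr p) \<le> norm (real k powr p * indicator \<Omega> x :: real)"
      using v0
    proof eventually_elim
      case (elim x)
      have "\<bar>w x\<bar> powr p \<le> real k powr p" using cb p unfolding w_def by (intro powr_mono2) auto
      then show ?case using elim p by (cases "x \<in> \<Omega>") (auto simp: w_def c0)
    qed
  qed measurable
  then have wE: "w \<in> energy_space \<Omega> \<sigma> p" unfolding energy_space_def using wX by (simp add: Lp_iff)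
  have P0: "0 \<le> P" unfolding P_def by simp
  \<comment> \<open>The energy of \<open>t * w\<close> is t^2 ((E - I)/2 + t^(p-2) P/p). The choice
    t^(p-2) = q makes the second term smaller than (I - E)/2; \<open>P + 1\<close> instead of
    \<open>P\<close> avoids a zero denominator and keeps the inequality strict.\<close>
  define q where "q = (I - E) * p / (2 * (P + 1))"
  have q: "0 < q" unfolding q_def using EI p P0 by simp
  define t where "t = q powr (1 / (p - 2))"
  have t: "0 < t" unfolding t_def using q by simp
  have tq: "t powr (p - 2) = q" unfolding t_def using q p by (simp add: powr_powr)
  have "q * P / p < (I - E) / 2"
  proof -
    have "q / p = (I - E) / (2 * (P + 1))" unfolding q_def using p by simp
    moreover have "q * P / p = q / p * P" by simp
    ultimately have "q * P / p = (I - E) / (2 * (P + 1)) * P" by (simp only:)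
    also have "\<dots> = (I - E) / 2 * (P / (P + 1))" by simp
    also have "\<dots> < (I - E) / 2 * 1" using EI P0 by (intro mult_strict_left_mono) auto
    finally show ?thesis by simp
  qed
  moreover have "(E - I) / 2 = - ((I - E) / 2)" by (simp add: diff_divide_distrib)
  ultimately have "(E - I) / 2 + q * P / p < 0" 
    by (simp only: add.commute[of "- _"] add_uminus_conv_diff diff_less_0_iff_less)
  then have "t\<^sup>2 * ((E - I) / 2 + q * P / p) < 0"
    using t by (intro mult_pos_neg) auto
  moreover have "energy \<sigma> p (\<lambda>x. t * w x) = t\<^sup>2 * ((E - I) / 2 + q * P / p)"
  proof -
    have tp: "t powr p = t\<^sup>2 * q"
    proof -
      have "t powr p = t powr 2 * t powr (p - 2)" by (simp only: powr_add[symmetric]) simp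
      then show ?thesis using t tq by simp
    qed
    show ?thesis
      unfolding energy_def X0_inner_scale[OF wX] E_def[symmetric]
      using t by (simp add: power_mult_distrib abs_mult powr_mult I_def[symmetric] P_def[symmetric] tp field_simps)
  qed
  moreover have "(\<lambda>x. t * w x) \<in> energy_space \<Omega> \<sigma> p"
    using energy_space_add_scaled[OF zero_in_energy_space wE, of t] p by simp
  ultimately show thesis by (intro that) auto
qed

subsection \<open>The Euler--Lagrange equation\<close>

text \<open>The tangent inequality of the convex function |t|^p, whose derivative is
  \<open>p * beta p t\<close>, obtained from Young's inequality with exponents p and p/(p-1). The
  tangent is taken at \<open>b\<close>, which will be the perturbed point, so that the growth of the
  power term is bounded from above.\<close>

lemma abs_powr_convex:
  fixes a b p :: real
  assumes p: "1 < p"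
  shows "\<bar>b\<bar> powr p \<le> \<bar>a\<bar> powr p + p * (beta p b * (b - a))"
proof -
  have bb: "beta p b * b = \<bar>b\<bar> powr p"
  proof -
    have "\<bar>b\<bar> powr p = \<bar>b\<bar> powr (p - 1) * \<bar>b\<bar> powr 1" by (simp only: powr_add[symmetric]) simp
    then show ?thesis unfolding beta_def by (simp add: sgn_if)
  qed
  have "beta p b * a \<le> \<bar>beta p b * a\<bar>" by simp
  also have "\<dots> \<le> \<bar>a\<bar> * \<bar>b\<bar> powr (p - 1)"
    unfolding beta_def by (simp add: abs_mult sgn_if)
  also have "\<dots> \<le> \<bar>a\<bar> powr p / p + (\<bar>b\<bar> powr (p - 1)) powr (p / (p - 1)) / (p / (p - 1))"
    using p by (intro Youngs_inequality) (auto simp: field_simps)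
  also have "\<dots> = \<bar>a\<bar> powr p / p + \<bar>b\<bar> powr p * (p - 1) / p"
    using p by (simp add: powr_powr)
  finally have "p * (beta p b * a) \<le> p * (\<bar>a\<bar> powr p / p + \<bar>b\<bar> powr p * (p - 1) / p)"
    using p by (intro mult_left_mono) auto
  also have "\<dots> = \<bar>a\<bar> powr p + (p - 1) * \<bar>b\<bar> powr p"
    using p by (simp add: field_simps)
  finally have "p * (beta p b * a) \<le> \<bar>a\<bar> powr p + (p - 1) * \<bar>b\<bar> powr p" .
  then show ?thesis unfolding right_diff_distrib bb by (simp add: left_diff_distrib)
qed

text \<open>At 0 the sign jumps, and continuity comes from the factor |t|^(p-1), which tends to 0
  because \<open>1 < p\<close>.\<close>

lemma tendsto_beta:
  assumes p: "1 < p" and f: "(f \<longlongrightarrow> a) F"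
  shows "((\<lambda>x. beta p (f x)) \<longlongrightarrow> beta p a) F"
proof (cases "a = 0")
  case True
  have "((\<lambda>x. \<bar>f x\<bar> powr (p - 1)) \<longlongrightarrow> \<bar>a\<bar> powr (p - 1)) F"
    by (intro tendsto_powr' tendsto_rabs f tendsto_const) (use p in auto)
  then have l: "((\<lambda>x. \<bar>f x\<bar> powr (p - 1)) \<longlongrightarrow> 0) F" using True p by simp
  have "norm (beta p (f x)) \<le> \<bar>f x\<bar> powr (p - 1)" for x
    unfolding beta_def by (simp add: abs_mult sgn_if)
  then have "((\<lambda>x. beta p (f x)) \<longlongrightarrow> 0) F"
    by (intro Lim_null_comparison[OF _ l] always_eventually allI)
  then show ?thesis using True by (simp add: beta_def)
next
  case False
  then show ?thesis unfolding beta_def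
    by (intro tendsto_mult tendsto_powr' tendsto_rabs tendsto_sgn f tendsto_const) (use p in auto)
qed

lemma beta_measurable [measurable]: "beta p \<in> borel_measurable borel"
  unfolding beta_def by measurable

text \<open>A pointwise substitute for Hoelder's inequality: |a| + |b| dominates both
  factors.\<close>

lemma abs_beta_mult_le:
  assumes "1 < p"
  shows "\<bar>beta p a * b\<bar> \<le> (\<bar>a\<bar> + \<bar>b\<bar>) powr p"
proof -
  have "\<bar>beta p a * b\<bar> \<le> \<bar>a\<bar> powr (p - 1) * \<bar>b\<bar>"
    unfolding beta_def by (simp add: abs_mult sgn_if)
  also have "\<dots> \<le> (\<bar>a\<bar> + \<bar>b\<bar>) powr (p - 1) * (\<bar>a\<bar> + \<bar>b\<bar>) powr 1"
    using assms by (intro mult_mono powr_mono2) auto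
  also have "\<dots> = (\<bar>a\<bar> + \<bar>b\<bar>) powr p" by (simp only: powr_add[symmetric]) simp
  finally show ?thesis .
qed

text \<open>The tangent inequality bounds the energy increment along \<open>\<phi>\<close> by
  \<open>t n * A n\<close>. Minimality makes \<open>A n\<close> nonnegative, and its limit is the
  asserted expression. The limit concerns beta(u + t \<phi>) \<phi> itself, so dominated convergence
  needs no difference quotients.\<close>

lemma minimizer_variation_nonneg:
  fixes u \<phi> :: "'a::euclidean_space \<Rightarrow> real"
  assumes u: "u \<in> energy_space \<Omega> \<sigma> p" and \<phi>: "\<phi> \<in> energy_space \<Omega> \<sigma> p" and p: "1 < p"
    and min: "\<And>w. w \<in> energy_space \<Omega> \<sigma> p \<Longrightarrow> energy \<sigma> p u \<le> energy \<sigma> p w"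
  shows "0 \<le> X0_inner \<sigma> u \<phi> + (LINT x|lborel. beta p (u x) * \<phi> x) - (LINT x|lborel. u x * \<phi> x)"
proof -
  have uX: "u \<in> X0 \<Omega> \<sigma>" and \<phi>X: "\<phi> \<in> X0 \<Omega> \<sigma>" using u \<phi> by (auto simp: energy_space_def)
  have [measurable]: "u \<in> borel_measurable lborel" "\<phi> \<in> borel_measurable lborel"
    and u2: "integrable lborel (\<lambda>x. (u x)\<^sup>2)" and \<phi>2: "integrable lborel (\<lambda>x. (\<phi> x)\<^sup>2)"
    and up: "integrable lborel (\<lambda>x. \<bar>u x\<bar> powr p)" and \<phi>p: "integrable lborel (\<lambda>x. \<bar>\<phi> x\<bar> powr p)"
    using u \<phi> by (auto simp: energy_space_def X0_iff Lp_iff)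
  have u\<phi>: "integrable lborel (\<lambda>x. u x * \<phi> x)" by (intro integrable_mult_L2 u2 \<phi>2) measurable
  define t where "t = (\<lambda>n::nat. 1 / real (Suc n))"
  have t: "0 < t n" "t n \<le> 1" for n unfolding t_def by auto
  have t0: "t \<longlonglongrightarrow> 0" unfolding t_def by (rule LIMSEQ_Suc[OF lim_1_over_n])
  \<comment> \<open>Since \<open>t n \<le> 1\<close>, the sum |u + t \<phi>| + |\<phi>| is at most
    |u| + 2 |\<phi>|, and this majorant is independent of \<open>n\<close>.\<close>
  define g where "g = (\<lambda>x. 2 powr p * (\<bar>u x\<bar> powr p + (2 * \<bar>\<phi> x\<bar>) powr p))"
  have g: "integrable lborel g" unfolding g_def using up \<phi>p by (simp add: powr_mult)
  have dom: "\<bar>beta p (u x + t n * \<phi> x) * \<phi> x\<bar> \<le> g x" for n x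
  proof -
    have "\<bar>t n * \<phi> x\<bar> \<le> \<bar>\<phi> x\<bar>" using t[of n] by (simp add: abs_mult mult_left_le_one_le)
    then have "\<bar>u x + t n * \<phi> x\<bar> + \<bar>\<phi> x\<bar> \<le> \<bar>u x\<bar> + \<bar>2 * \<phi> x\<bar>" by linarith
    then have "(\<bar>u x + t n * \<phi> x\<bar> + \<bar>\<phi> x\<bar>) powr p \<le> (\<bar>u x\<bar> + \<bar>2 * \<phi> x\<bar>) powr p"
      using p by (intro powr_mono2) auto
    also have "\<dots> \<le> 2 powr p * (\<bar>u x\<bar> powr p + \<bar>2 * \<phi> x\<bar> powr p)"
      by (rule abs_add_powr_le) (use p in simp)
    finally show ?thesis using abs_beta_mult_le[OF p, of "u x + t n * \<phi> x" "\<phi> x"]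
      unfolding g_def by (simp add: abs_mult)
  qed
  have bi: "integrable lborel (\<lambda>x. beta p (u x + t n * \<phi> x) * \<phi> x)" for n
    by (rule Bochner_Integration.integrable_bound[OF g]) (use dom in \<open>auto intro!: AE_I2 intro: order_trans[OF _ abs_ge_self]\<close>)
  have lim: "(\<lambda>n. LINT x|lborel. beta p (u x + t n * \<phi> x) * \<phi> x) \<longlonglongrightarrow> (LINT x|lborel. beta p (u x) * \<phi> x)"
  proof (rule integral_dominated_convergence[OF _ _ g])
    show "AE x in lborel. (\<lambda>n. beta p (u x + t n * \<phi> x) * \<phi> x) \<longlonglongrightarrow> beta p (u x) * \<phi> x"
    proof (intro AE_I2 tendsto_mult tendsto_beta[OF p] tendsto_const)
      fix x
      have "(\<lambda>n. u x + t n * \<phi> x) \<longlonglongrightarrow> u x + 0 * \<phi> x" by (intro tendsto_intros t0)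
      then show "(\<lambda>n. u x + t n * \<phi> x) \<longlonglongrightarrow> u x" by simp
    qed
    show "AE x in lborel. norm (beta p (u x + t n * \<phi> x) * \<phi> x) \<le> g x" for n
      using dom[of _ n] by simp
  qed measurable
  define B where "B = (\<lambda>n. LINT x|lborel. beta p (u x + t n * \<phi> x) * \<phi> x)"
  define A where "A = (\<lambda>n. X0_inner \<sigma> u \<phi> + t n * (X0_inner \<sigma> \<phi> \<phi> / 2) + B n
    - (LINT x|lborel. u x * \<phi> x) - t n * ((LINT x|lborel. (\<phi> x)\<^sup>2) / 2))"
  have "A \<longlonglongrightarrow> X0_inner \<sigma> u \<phi> + 0 * (X0_inner \<sigma> \<phi> \<phi> / 2) + (LINT x|lborel. beta p (u x) * \<phi> x)
    - (LINT x|lborel. u x * \<phi> x) - 0 * ((LINT x|lborel. (\<phi> x)\<^sup>2) / 2)"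
    unfolding A_def B_def by (intro tendsto_add tendsto_diff tendsto_mult tendsto_const t0 lim)
  moreover have "0 \<le> A n" for n
  proof -
    define w where "w = (\<lambda>x. u x + t n * \<phi> x)"
    have wE: "w \<in> energy_space \<Omega> \<sigma> p"
      unfolding w_def by (rule energy_space_add_scaled[OF u \<phi>]) (use p in simp)
    then have wp: "integrable lborel (\<lambda>x. \<bar>w x\<bar> powr p)" by (auto simp: energy_space_def Lp_iff)
    have Xw: "X0_inner \<sigma> w w = X0_inner \<sigma> u u + 2 * t n * X0_inner \<sigma> u \<phi> + (t n)\<^sup>2 * X0_inner \<sigma> \<phi> \<phi>"
      unfolding w_def by (rule X0_inner_add_scaled[OF uX \<phi>X])
    have "(LINT x|lborel. (w x)\<^sup>2) = (LINT x|lborel. (u x)\<^sup>2 + 2 * t n * (u x * \<phi> x) + (t n)\<^sup>2 * (\<phi> x)\<^sup>2)"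
      unfolding w_def by (intro Bochner_Integration.integral_cong) (auto simp: power2_eq_square algebra_simps)
    also have "\<dots> = (LINT x|lborel. (u x)\<^sup>2) + 2 * t n * (LINT x|lborel. u x * \<phi> x) + (t n)\<^sup>2 * (LINT x|lborel. (\<phi> x)\<^sup>2)"
      using u2 u\<phi> \<phi>2 by simp
    finally have w2: "(LINT x|lborel. (w x)\<^sup>2) = (LINT x|lborel. (u x)\<^sup>2)
      + 2 * t n * (LINT x|lborel. u x * \<phi> x) + (t n)\<^sup>2 * (LINT x|lborel. (\<phi> x)\<^sup>2)" .
    have "(LINT x|lborel. \<bar>w x\<bar> powr p) \<le> (LINT x|lborel. \<bar>u x\<bar> powr p + p * t n * (beta p (w x) * \<phi> x))"
    proof (rule integral_mono[OF wp])
      show "integrable lborel (\<lambda>x. \<bar>u x\<bar> powr p + p * t n * (beta p (w x) * \<phi> x))"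
        using up bi[of n] unfolding w_def by simp
      show "\<bar>w x\<bar> powr p \<le> \<bar>u x\<bar> powr p + p * t n * (beta p (w x) * \<phi> x)" for x
        using abs_powr_convex[OF p, of "w x" "u x"] by (simp add: w_def mult_ac)
    qed
    also have "\<dots> = (LINT x|lborel. \<bar>u x\<bar> powr p) + p * t n * B n"
      using up bi[of n] unfolding w_def B_def by simp
    finally have wp': "(LINT x|lborel. \<bar>w x\<bar> powr p) / p \<le> (LINT x|lborel. \<bar>u x\<bar> powr p) / p + t n * B n"
      using p by (simp add: field_simps)
    have "0 \<le> energy \<sigma> p w - energy \<sigma> p u" using min[OF wE] by simp
    also have "\<dots> \<le> t n * X0_inner \<sigma> u \<phi> + (t n)\<^sup>2 * X0_inner \<sigma> \<phi> \<phi> / 2 + t n * B n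
        - t n * (LINT x|lborel. u x * \<phi> x) - (t n)\<^sup>2 * (LINT x|lborel. (\<phi> x)\<^sup>2) / 2"
      unfolding energy_def Xw w2 using wp' by (simp add: add_divide_distrib diff_divide_distrib)
    also have "\<dots> = t n * A n" unfolding A_def by (simp add: power2_eq_square algebra_simps)
    finally show ?thesis using t(1)[of n] by (simp add: zero_le_mult_iff)
  qed
  ultimately show ?thesis by (intro LIMSEQ_le_const[of A]) auto
qed

lemma X0_inner_minus: "X0_inner r u (\<lambda>x. - v x) = - X0_inner r u v"
proof -
  have "gagliardo_form r u (\<lambda>x. - v x) = (\<lambda>z. - gagliardo_form r u v z)"
    by (auto simp: fun_eq_iff gagliardo_form_def algebra_simps minus_divide_left)
  then show ?thesis unfolding X0_inner_def by simp
qed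

lemma minimizer_weak_solution:
  fixes \<Omega> :: "'a::euclidean_space set"
  assumes \<Omega>: "open \<Omega>" and u: "u \<in> energy_space \<Omega> \<sigma> p" and p: "1 < p"
    and min: "\<And>w. w \<in> energy_space \<Omega> \<sigma> p \<Longrightarrow> energy \<sigma> p u \<le> energy \<sigma> p w"
  shows "weak_solution \<Omega> \<sigma> p u"
  unfolding weak_solution_def
proof (intro conjI ballI u)
  fix \<phi> assume \<phi>: "\<phi> \<in> energy_space \<Omega> \<sigma> p"
  have [measurable]: "u \<in> borel_measurable lborel" "\<phi> \<in> borel_measurable lborel"
    and u0: "AE x in lborel. x \<notin> \<Omega> \<longrightarrow> u x = 0"
    using u \<phi> by (auto simp: energy_space_def X0_iff)
  have r1: "(LINT x:\<Omega>|lborel. beta p (u x) * \<phi> x) = (LINT x|lborel. beta p (u x) * \<phi> x)"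
    by (rule LINT_restrict_eq[OF \<Omega>]) (use u0 in \<open>eventually_elim, auto simp: beta_def\<close>, measurable)
  have r2: "(LINT x:\<Omega>|lborel. u x * \<phi> x) = (LINT x|lborel. u x * \<phi> x)"
    by (rule LINT_restrict_eq[OF \<Omega>]) (use u0 in \<open>eventually_elim, auto\<close>, measurable)
  have m: "(\<lambda>x. - \<phi> x) \<in> energy_space \<Omega> \<sigma> p"
    using energy_space_add_scaled[OF zero_in_energy_space \<phi>, of "-1"] p by simp
  have "0 \<le> X0_inner \<sigma> u \<phi> + (LINT x|lborel. beta p (u x) * \<phi> x) - (LINT x|lborel. u x * \<phi> x)"
    by (rule minimizer_variation_nonneg[OF u \<phi> p min])
  moreover have "0 \<le> X0_inner \<sigma> u (\<lambda>x. - \<phi> x) + (LINT x|lborel. beta p (u x) * - \<phi> x) - (LINT x|lborel. u x * - \<phi> x)"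
    by (rule minimizer_variation_nonneg[OF u m p min])
  ultimately show "X0_inner \<sigma> u \<phi> + (LINT x:\<Omega>|lborel. beta p (u x) * \<phi> x) - (LINT x:\<Omega>|lborel. u x * \<phi> x) = 0"
    unfolding r1 r2 by (simp add: X0_inner_minus)
qed

section \<open>Existence of a nontrivial weak solution\<close>

theorem proposition6p1:
  fixes \<Omega> :: "'a::euclidean_space set" and \<sigma> p :: real
  assumes "bounded_smooth_domain \<Omega>"
    and "0 < \<sigma>" and "\<sigma> < 1"
    and "2 < p"
    and "first_eigenvalue \<Omega> \<sigma> < 1"
  shows "\<exists>u. weak_solution \<Omega> \<sigma> p u \<and> \<not> (AE x in lborel. u x = 0)"
proof -
  have \<Omega>: "bounded \<Omega>" "open \<Omega>" "\<Omega> \<noteq> {}"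
    using assms(1) by (auto simp: bounded_smooth_domain_def)
  note \<sigma> = assms(2,3) and p = assms(4)
  obtain v where v: "v \<in> X0 \<Omega> \<sigma>" "(LINT x|lborel. (v x)\<^sup>2) = 1" "X0_inner \<sigma> v v < 1"
    using first_eigenvalue_attained[OF \<Omega> \<sigma>] assms(5) by metis
  obtain w where w: "w \<in> energy_space \<Omega> \<sigma> p" "energy \<sigma> p w < 0"
    by (rule energy_neg[OF \<Omega>(1,2) \<sigma> p v])
  obtain u where u: "u \<in> energy_space \<Omega> \<sigma> p"
    and min: "\<And>w. w \<in> energy_space \<Omega> \<sigma> p \<Longrightarrow> energy \<sigma> p u \<le> energy \<sigma> p w"
    using energy_minimizer[OF \<Omega>(1,2) \<sigma> p] by blast
  have sol: "weak_solution \<Omega> \<sigma> p u"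
    using p by (intro minimizer_weak_solution \<Omega>(2) u min) auto
  \<comment> \<open>For a function vanishing almost everywhere the only negative term of the energy
    is 0, so its energy could not lie below that of \<open>w\<close>.\<close>
  have "\<not> (AE x in lborel. u x = 0)"
  proof
    assume "AE x in lborel. u x = 0"
    then have "AE x in lborel. (u x)\<^sup>2 = 0" by eventually_elim simp
    then have "(LINT x|lborel. (u x)\<^sup>2) = 0" by (rule integral_eq_zero_AE)
    moreover have "0 \<le> X0_inner \<sigma> u u" by (rule X0_inner_nonneg[OF \<sigma>])
    moreover have "0 \<le> (LINT x|lborel. \<bar>u x\<bar> powr p) / p" using p by simp
    ultimately have "0 \<le> energy \<sigma> p u" unfolding energy_def by linarith
    then show False using min[OF w(1)] w(2) by linarith
  qed
  with sol show ?thesis by blast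
qed

end
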